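(* The sequence of groups $0\to\ell_0\to\mathcal{GA}\to Aut(X,\mu)\to 0$, where $\ell_0\to\mathcal{GA}$ is the inclusion and $\mathcal{GA}\to Aut(X,\mu)$ is the map $p\mapsto p|_X$, is a short exact sequence.
   Context: Fix a non-principal ultrafilter $\omega$ on $\mathbb{N}$ and a (strictly) increasing sequence $(n_k)_k$ of natural numbers. Universal sofic group: for $p\in Sym(n)$ the normalised Hamming length is $\ell_H(p)=\frac1n Card\{i:p(i)\neq i\}$. The universal sofic group $\Pi_{k\to\omega}Sym(n_k)$ is the quotient of $\prod_k Sym(n_k)$ by the normal subgroup $\{(p_k)_k:\lim_{k\to\omega}\ell_H(p_k)=0\}$; the class of $(p_k)_k$ is written $\Pi_{k\to\omega}p_k$. Loeb space: $X_\omega=\prod_k\{1,\ldots,n_k\}/\sim$, where $(x_k)_k\sim(y_k)_k$ iff $\{k:x_k=y_k\}\in\omega$; the class of $(x_k)_k$ is still written $(x_k)_k$. For $A_k\subset\{1,\ldots,n_k\}$ put $\Pi_{k\to\omega}A_k=\{(x_k)_k\in X_\omega:\{k:x_k\in A_k\}\in\omega\}$ and $\mu_\omega(\Pi_{k\to\omega}A_k)=\lim_{k\to\omega}Card(A_k)/n_k$. These sets form an algebra on which $\mu_\omega$ is a pre-measure; $(X_\omega,\mathcal{B}_\omega,\mu_\omega)$ is the completion of its Carathéodory extension to the generated $\sigma$-algebra. Action: $p=\Pi_{k\to\omega}p_k$ acts on $X_\omega$ by $p((x_k)_k)=(p_k(x_k))_k$; this is a measure-preserving automorphism of $(X_\omega,\mu_\omega)$,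 well defined up to a $\mu_\omega$-null set. Standard part: $X=[0,1]$ with Lebesgue measure $\mu$, and $St:X_\omega\to X$, $St((x_k)_k)=\lim_{k\to\omega}\frac{x_k}{n_k}$ (it is measure preserving). $Aut(X,\mu)$ is the group of measure-preserving automorphisms of $(X,\mu)$, with two automorphisms identified if they agree $\mu$-almost everywhere. $p|_X$ and $\mathcal{GA}$: for $p\in\Pi_{k\to\omega}Sym(n_k)$ we say $p|_X$ exists, and write $p|_X=\varphi$, if there is $\varphi:X\to X$ with $St(p(x))=\varphi(St(x))$ for $\mu_\omega$-almost all $x\in X_\omega$ ($\varphi$ is then determined $\mu$-almost everywhere). $\mathcal{GA}$ is the set of $p\in\Pi_{k\to\omega}Sym(n_k)$ such that $p|_X$ exists and is an automorphism of $(X,\mu)$ (invertible modulo null sets); it is a subgroup. Coxeter length: for $p\in Sym(n)$, $n\geqslant2$, $\ell_C(p)=\frac2{n(n-1)}Card\{i<j:p(i)>p(j)\}$. On the universal sofic group, $\ell_C(\Pi_{k\to\omega}p_k)=\lim_{k\to\omega}\ell_C(p_k)$ (well defined), and $\ell_0=\{p\in\Pi_{k\to\omega}Sym(n_k):\ell_C(p)=0\}$. *)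

theory Defs
  imports
    "HOL-Analysis.Analysis"
    "HOL-Algebra.Product_Groups"
    "HOL-Algebra.Sym_Groups"
begin

text \<open>
  An ultrafilter on the index set is a \<^typ>\<open>nat filter\<close>; the relation
  \<open>{k. P k} \<in> \<omega>\<close> is \<open>eventually P \<omega>\<close> and \<open>lim\<^bsub>k\<rightarrow>\<omega>\<^esub> f k = r\<close> is \<open>(f \<longlongrightarrow> r) \<omega>\<close>.
\<close>

definition nonprincipal_ultrafilter :: "nat filter \<Rightarrow> bool" where
  "nonprincipal_ultrafilter \<omega> \<longleftrightarrow>
     \<omega> \<noteq> bot \<and>
     (\<forall>P. eventually P \<omega> \<or> eventually (\<lambda>k. \<not> P k) \<omega>) \<and>
     (\<forall>m. \<not> eventually (\<lambda>k. k = m) \<omega>)"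


section \<open>The universal sofic group\<close>

definition hamming_length :: "nat \<Rightarrow> (nat \<Rightarrow> nat) \<Rightarrow> real" where
  "hamming_length m p = real (card {i \<in> {1..m}. p i \<noteq> i}) / real m"

definition sym_product :: "(nat \<Rightarrow> nat) \<Rightarrow> (nat \<Rightarrow> nat \<Rightarrow> nat) monoid" where
  "sym_product n = product_group UNIV (\<lambda>k. sym_group (n k))"

definition hamming_null :: "nat filter \<Rightarrow> (nat \<Rightarrow> nat) \<Rightarrow> (nat \<Rightarrow> nat \<Rightarrow> nat) set" where
  "hamming_null \<omega> n =
     {p \<in> carrier (sym_product n). ((\<lambda>k. hamming_length (n k) (p k)) \<longlongrightarrow> 0) \<omega>}"

text \<open>Elements of the universal sofic group are cosets, i.e. sets of sequences of permutations.\<close>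

definition sofic_group :: "nat filter \<Rightarrow> (nat \<Rightarrow> nat) \<Rightarrow> (nat \<Rightarrow> nat \<Rightarrow> nat) set monoid" where
  "sofic_group \<omega> n = sym_product n Mod hamming_null \<omega> n"


section \<open>The Loeb space\<close>

definition loeb_seqs :: "(nat \<Rightarrow> nat) \<Rightarrow> (nat \<Rightarrow> nat) set" where
  "loeb_seqs n = (\<Pi>\<^sub>E k\<in>UNIV. {1..n k})"

definition loeb_rel :: "nat filter \<Rightarrow> (nat \<Rightarrow> nat) \<Rightarrow> ((nat \<Rightarrow> nat) \<times> (nat \<Rightarrow> nat)) set" where
  "loeb_rel \<omega> n =
     {(x, y). x \<in> loeb_seqs n \<and> y \<in> loeb_seqs n \<and> eventually (\<lambda>k. x k = y k) \<omega>}"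

definition loeb_points :: "nat filter \<Rightarrow> (nat \<Rightarrow> nat) \<Rightarrow> (nat \<Rightarrow> nat) set set" where
  "loeb_points \<omega> n = loeb_seqs n // loeb_rel \<omega> n"

definition internal_set ::
  "nat filter \<Rightarrow> (nat \<Rightarrow> nat) \<Rightarrow> (nat \<Rightarrow> nat set) \<Rightarrow> (nat \<Rightarrow> nat) set set" where
  "internal_set \<omega> n A =
     {c \<in> loeb_points \<omega> n. \<exists>x\<in>c. eventually (\<lambda>k. x k \<in> A k) \<omega>}"

definition loeb_algebra :: "nat filter \<Rightarrow> (nat \<Rightarrow> nat) \<Rightarrow> (nat \<Rightarrow> nat) set set set" where
  "loeb_algebra \<omega> n = internal_set \<omega> n ` {A. \<forall>k. A k \<subseteq> {1..n k}}"

definition loeb_premeasure ::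
  "nat filter \<Rightarrow> (nat \<Rightarrow> nat) \<Rightarrow> (nat \<Rightarrow> nat) set set \<Rightarrow> ennreal" where
  "loeb_premeasure \<omega> n S =
     ennreal (THE r. \<exists>A. (\<forall>k. A k \<subseteq> {1..n k}) \<and> S = internal_set \<omega> n A \<and>
                         ((\<lambda>k. real (card (A k)) / real (n k)) \<longlongrightarrow> r) \<omega>)"

text \<open>
  The Caratheodory extension is the restriction of the outer measure induced by the pre-measure
  to the generated sigma-algebra (which \<^const>\<open>measure_of\<close> forms).
\<close>

definition loeb_measure :: "nat filter \<Rightarrow> (nat \<Rightarrow> nat) \<Rightarrow> (nat \<Rightarrow> nat) set measure" where
  "loeb_measure \<omega> n =
     completion (measure_of (loeb_points \<omega> n) (loeb_algebra \<omega> n)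
       (outer_measure (loeb_algebra \<omega> n) (loeb_premeasure \<omega> n)))"

text \<open>
  The action on \<^const>\<open>loeb_points\<close> of a sequence of permutations: the class of \<open>x\<close> is sent to the
  class of \<open>(p k (x k))\<^sub>k\<close>.  Representatives of the same element of the universal sofic group give
  actions that agree almost everywhere.
\<close>

definition loeb_act ::
  "nat filter \<Rightarrow> (nat \<Rightarrow> nat) \<Rightarrow> (nat \<Rightarrow> nat \<Rightarrow> nat) \<Rightarrow> (nat \<Rightarrow> nat) set \<Rightarrow> (nat \<Rightarrow> nat) set" where
  "loeb_act \<omega> n p c = (\<Union>x\<in>c. loeb_rel \<omega> n `` {\<lambda>k. p k (x k)})"

definition standard_part :: "nat filter \<Rightarrow> (nat \<Rightarrow> nat) \<Rightarrow> (nat \<Rightarrow> nat) set \<Rightarrow> real" where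
  "standard_part \<omega> n c =
     (THE r. \<exists>x\<in>c. ((\<lambda>k. real (x k) / real (n k)) \<longlongrightarrow> r) \<omega>)"


section \<open>The automorphism group of a measure space\<close>

definition measure_preserving_maps :: "'a measure \<Rightarrow> ('a \<Rightarrow> 'a) set" where
  "measure_preserving_maps M =
     {f \<in> measurable M M. \<forall>A\<in>sets M. emeasure M (f -` A \<inter> space M) = emeasure M A}"

text \<open>
  Automorphisms are invertible modulo null sets.  They are total functions on the type; values
  outside \<^term>\<open>space M\<close> are irrelevant because of the passage to almost-everywhere classes.
\<close>

definition automorphisms :: "'a measure \<Rightarrow> ('a \<Rightarrow> 'a) set" where
  "automorphisms M =
     {f \<in> measure_preserving_maps M. \<exists>g\<in>measure_preserving_maps M.
        (AE x in M. g (f x) = x) \<and> (AE x in M. f (g x) = x)}"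

definition ae_rel :: "'a measure \<Rightarrow> (('a \<Rightarrow> 'a) \<times> ('a \<Rightarrow> 'a)) set" where
  "ae_rel M =
     {(f, g). f \<in> automorphisms M \<and> g \<in> automorphisms M \<and> (AE x in M. f x = g x)}"

definition Aut_group :: "'a measure \<Rightarrow> ('a \<Rightarrow> 'a) set monoid" where
  "Aut_group M =
     \<lparr>carrier = automorphisms M // ae_rel M,
      monoid.mult = (\<lambda>C D. \<Union>f\<in>C. \<Union>g\<in>D. ae_rel M `` {f \<circ> g}),
      one = ae_rel M `` {id}\<rparr>"

abbreviation unit_interval :: "real measure" where
  "unit_interval \<equiv> lebesgue_on {0..1}"


section \<open>Elements of the sofic group that restrict to the standard part\<close>

text \<open>\<open>restricts_to \<omega> n P \<phi>\<close> is the relation \<open>p|\<^sub>X = \<phi>\<close> for the class \<open>P\<close> of \<open>p\<close>.\<close>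

definition restricts_to ::
  "nat filter \<Rightarrow> (nat \<Rightarrow> nat) \<Rightarrow> (nat \<Rightarrow> nat \<Rightarrow> nat) set \<Rightarrow> (real \<Rightarrow> real) \<Rightarrow> bool" where
  "restricts_to \<omega> n P \<phi> \<longleftrightarrow>
     \<phi> \<in> {0..1} \<rightarrow> {0..1} \<and>
     (\<forall>p\<in>P. AE x in loeb_measure \<omega> n.
        standard_part \<omega> n (loeb_act \<omega> n p x) = \<phi> (standard_part \<omega> n x))"

definition GA :: "nat filter \<Rightarrow> (nat \<Rightarrow> nat) \<Rightarrow> (nat \<Rightarrow> nat \<Rightarrow> nat) set set" where
  "GA \<omega> n =
     {P \<in> carrier (sofic_group \<omega> n). \<exists>\<phi>\<in>automorphisms unit_interval. restricts_to \<omega> n P \<phi>}"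

text \<open>
  Since \<open>p|\<^sub>X\<close> is determined only almost everywhere, the set of all automorphisms it may denote is
  precisely its class in \<^term>\<open>Aut_group unit_interval\<close>.
\<close>

definition restriction ::
  "nat filter \<Rightarrow> (nat \<Rightarrow> nat) \<Rightarrow> (nat \<Rightarrow> nat \<Rightarrow> nat) set \<Rightarrow> (real \<Rightarrow> real) set" where
  "restriction \<omega> n P = {\<phi> \<in> automorphisms unit_interval. restricts_to \<omega> n P \<phi>}"


section \<open>The Coxeter length\<close>

definition coxeter_length :: "nat \<Rightarrow> (nat \<Rightarrow> nat) \<Rightarrow> real" where
  "coxeter_length m p =
     2 / (real m * (real m - 1)) *
     real (card {(i, j). i \<in> {1..m} \<and> j \<in> {1..m} \<and> i < j \<and> p i > p j})"

definition sofic_coxeter_length ::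
  "nat filter \<Rightarrow> (nat \<Rightarrow> nat) \<Rightarrow> (nat \<Rightarrow> nat \<Rightarrow> nat) set \<Rightarrow> real" where
  "sofic_coxeter_length \<omega> n P =
     (THE r. \<exists>p\<in>P. ((\<lambda>k. coxeter_length (n k) (p k)) \<longlongrightarrow> r) \<omega>)"

definition ell0 :: "nat filter \<Rightarrow> (nat \<Rightarrow> nat) \<Rightarrow> (nat \<Rightarrow> nat \<Rightarrow> nat) set set" where
  "ell0 \<omega> n = {P \<in> carrier (sofic_group \<omega> n). sofic_coxeter_length \<omega> n P = 0}"


section \<open>Short exact sequences\<close>

text \<open>
  Exactness of \<open>0 \<rightarrow> A \<rightarrow> B \<rightarrow> C \<rightarrow> 0\<close> at each of the three groups.  The predicate
  \<open>short_exact_sequence\<close> of HOL-Algebra requires all groups to have elements of one type.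
\<close>

definition short_exact ::
  "('a, 'm) monoid_scheme \<Rightarrow> ('b, 'n) monoid_scheme \<Rightarrow> ('c, 'k) monoid_scheme \<Rightarrow>
   ('a \<Rightarrow> 'b) \<Rightarrow> ('b \<Rightarrow> 'c) \<Rightarrow> bool" where
  "short_exact A B C f g \<longleftrightarrow>
     group A \<and> group B \<and> group C \<and> f \<in> hom A B \<and> g \<in> hom B C \<and>
     kernel A B f = {\<one>\<^bsub>A\<^esub>} \<and>
     kernel B C g = f ` carrier A \<and>
     g ` carrier B = carrier C"

end

theory Submission
  imports Defs "HOL-Probability.Distribution_Functions"
begin

text \<open>
  The Loeb measure is built from internal sets by Caratheodory's theorem, countable additivity being
  a consequence of \<open>\<omega>\<^sub>1\<close>-saturation of the ultraproduct. Since the standard part map is measure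
  preserving, \<open>p|\<^sub>X\<close> is unique modulo null sets, and the composition and inversion of sequences of
  permutations carry over to automorphisms.

  The kernel is identified through the footrule \<open>\<Sum>\<^sub>i \<bar>p i - i\<bar>\<close>, which agrees with the number of
  inversions up to constant factors: both are \<open>o(n\<^sup>2)\<close> iff almost every point is moved by an
  infinitesimal amount, that is, iff \<open>St (p x) = St x\<close> almost everywhere.

  For surjectivity, an automorphism \<open>\<phi>\<close> is lifted to the internal function \<open>F\<close> that averages \<open>\<phi>\<close> over
  the cells \<open>[(i - 1)/n, i/n]\<close>, and \<open>p\<close> sends \<open>i\<close> to the rank of \<open>F i\<close>. Then \<open>p x / n\<close> is
  infinitely close to the measure of \<open>{y. \<phi> (St y) < \<phi> (St x)}\<close>, which is \<open>\<phi> (St x)\<close> because \<open>\<phi>\<close>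
  preserves the measure.
\<close>

section \<open>Ultrafilter limits, internal sets and the Loeb measure\<close>

text \<open>The obstacle to surjectivity is that \<phi> is known only modulo null sets: sampling it
  at the points i/n would see only a null set of arguments, whereas averages over cells depend on
  the class alone. The averages are close to \<phi> composed with St but need not form a
  permutation. Ranking turns any internal function into a permutation, at the price of composing it
  with its distribution function.

  Two measures are carried along. Generator and uniqueness arguments use \<open>L0\<close>, whose
  sigma-algebra is generated by the internal sets. But \<open>unit_interval\<close> contains every
  Lebesgue set, so the measurability of St into it is obtained for the completion \<open>L\<close>.
  Both measures have the same almost everywhere statements, which is how facts pass between them.

  The algebra is done on single sequences of permutations, through the predicate
  \<open>lift\<close>, and moved to cosets once the choice of representative is known not to
  matter.\<close>

declare One_nat_def [simp del]

locale loeb =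
  fixes \<omega> :: "nat filter" and n :: "nat \<Rightarrow> nat"
  assumes ultra: "nonprincipal_ultrafilter \<omega>"
    and mono: "strict_mono n"
    and pos: "\<And>k. n k \<ge> 1"
begin

lemma ultra_ne_bot [simp]: "\<omega> \<noteq> bot"
  using ultra by (simp add: nonprincipal_ultrafilter_def)

lemma eventually_not_iff: "eventually (\<lambda>k. \<not> P k) \<omega> \<longleftrightarrow> \<not> eventually P \<omega>"
proof
  assume *: "eventually (\<lambda>k. \<not> P k) \<omega>"
  show "\<not> eventually P \<omega>"
  proof
    assume "eventually P \<omega>"
    with * have "eventually (\<lambda>k. False) \<omega>" by eventually_elim simp
    then show False by simp
  qed
qed (use ultra in \<open>auto simp: nonprincipal_ultrafilter_def\<close>)

lemma eventually_disj_iff: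
  "eventually (\<lambda>k. P k \<or> Q k) \<omega> \<longleftrightarrow> eventually P \<omega> \<or> eventually Q \<omega>"
proof -
  have "eventually (\<lambda>k. \<not> (\<not> P k \<and> \<not> Q k)) \<omega> \<longleftrightarrow> eventually P \<omega> \<or> eventually Q \<omega>"
    unfolding eventually_not_iff eventually_conj_iff by simp
  then show ?thesis by simp
qed

text \<open>Non-principality discards each single index, hence by induction every initial segment.
  In this form it is used later: what holds for all large k holds along \<omega>.\<close>

lemma ultra_le_sequentially: "\<omega> \<le> sequentially"
  unfolding le_sequentially
proof
  fix N
  show "eventually (\<lambda>k. k \<ge> N) \<omega>"
  proof (induction N)
    case (Suc N)
    have "eventually (\<lambda>k. \<not> k = N) \<omega>"
      using ultra unfolding eventually_not_iff nonprincipal_ultrafilter_def by blast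
    with Suc show ?case by eventually_elim simp
  qed simp
qed

lemma eventually_ge_ultra: "eventually (\<lambda>k. k \<ge> N) \<omega>"
  using ultra_le_sequentially by (simp add: le_sequentially)

lemma index_gt: "k < n k"
proof (induction k)
  case 0
  show ?case using pos[of 0] by simp
next
  case (Suc k)
  then show ?case using strict_monoD[OF mono, of k "Suc k"] by simp
qed


text \<open>Compactness gives a cluster point of the image filter. For an ultrafilter a cluster
  point is a limit: if f were not eventually in an open neighbourhood, it would eventually be
  outside it.\<close>

lemma ultra_compact_limit:
  fixes f :: "nat \<Rightarrow> 'a::topological_space"
  assumes "compact K" "eventually (\<lambda>k. f k \<in> K) \<omega>"
  shows "\<exists>l\<in>K. (f \<longlongrightarrow> l) \<omega>"
proof -
  have "eventually (\<lambda>x. x \<in> K) (filtermap f \<omega>)" "filtermap f \<omega> \<noteq> bot"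
    using assms(2) by (auto simp: eventually_filtermap filtermap_bot_iff)
  then obtain l where l: "l \<in> K" "inf (nhds l) (filtermap f \<omega>) \<noteq> bot"
    using assms(1) unfolding compact_filter by blast
  have "(f \<longlongrightarrow> l) \<omega>"
  proof (rule topological_tendstoI, rule ccontr)
    fix S assume S: "open S" "l \<in> S" "\<not> (\<forall>\<^sub>F k in \<omega>. f k \<in> S)"
    then have "eventually (\<lambda>x. x \<notin> S) (filtermap f \<omega>)"
      by (simp add: eventually_filtermap eventually_not_iff)
    moreover have "eventually (\<lambda>x. x \<in> S) (nhds l)"
      using S by (simp add: eventually_nhds_in_open)
    ultimately have "eventually (\<lambda>x. False) (inf (nhds l) (filtermap f \<omega>))"
      unfolding eventually_inf by blast
    with l(2) show False by (simp add: trivial_limit_def)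
  qed
  with l(1) show ?thesis by blast
qed

lemma tendsto_Lim_ultra:
  fixes f :: "nat \<Rightarrow> real"
  assumes "\<And>k. f k \<in> {a..b}"
  shows "(f \<longlongrightarrow> Lim \<omega> f) \<omega>" "Lim \<omega> f \<in> {a..b}"
proof -
  obtain l where l: "l \<in> {a..b}" "(f \<longlongrightarrow> l) \<omega>"
    using ultra_compact_limit[of "{a..b}" f] assms by auto
  moreover from l have "Lim \<omega> f = l" by (simp add: tendsto_Lim)
  ultimately show "(f \<longlongrightarrow> Lim \<omega> f) \<omega>" "Lim \<omega> f \<in> {a..b}" by simp_all
qed

section \<open>Points of the Loeb space, internal sets and saturation\<close>

abbreviation cls :: "(nat \<Rightarrow> nat) \<Rightarrow> (nat \<Rightarrow> nat) set" where
  "cls x \<equiv> loeb_rel \<omega> n `` {x}"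

lemma loeb_seqs_iff: "x \<in> loeb_seqs n \<longleftrightarrow> (\<forall>k. x k \<in> {1..n k})"
  by (simp add: loeb_seqs_def PiE_iff)

lemma equiv_loeb_rel: "equiv (loeb_seqs n) (loeb_rel \<omega> n)"
proof (rule equivI)
  show "loeb_rel \<omega> n \<subseteq> loeb_seqs n \<times> loeb_seqs n" by (auto simp: loeb_rel_def)
  show "refl_on (loeb_seqs n) (loeb_rel \<omega> n)" by (auto simp: loeb_rel_def refl_on_def)
  show "sym (loeb_rel \<omega> n)" by (auto simp: loeb_rel_def sym_def eq_commute)
  show "trans (loeb_rel \<omega> n)"
    by (auto simp: loeb_rel_def trans_def elim: eventually_elim2)
qed

lemma mem_cls: "y \<in> cls x \<longleftrightarrow> x \<in> loeb_seqs n \<and> y \<in> loeb_seqs n \<and> eventually (\<lambda>k. x k = y k) \<omega>"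
  by (auto simp: loeb_rel_def)

lemma cls_self: "x \<in> loeb_seqs n \<Longrightarrow> x \<in> cls x"
  by (simp only: mem_cls) simp

lemma cls_eq_iff:
  assumes "x \<in> loeb_seqs n" "y \<in> loeb_seqs n"
  shows "cls x = cls y \<longleftrightarrow> eventually (\<lambda>k. x k = y k) \<omega>"
  using eq_equiv_class_iff[OF equiv_loeb_rel assms] assms by (simp add: loeb_rel_def)

lemma cls_in_points: "x \<in> loeb_seqs n \<Longrightarrow> cls x \<in> loeb_points \<omega> n"
  by (simp add: loeb_points_def quotientI)

lemma loeb_points_cases:
  assumes "c \<in> loeb_points \<omega> n"
  obtains x where "x \<in> loeb_seqs n" "c = cls x"
  using assms by (auto simp: loeb_points_def elim: quotientE)

text \<open>The existential over representatives collapses because two representatives agree on a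
  set of \<omega>. With \<open>points_eqI\<close> this makes the formation of internal sets commute
  with Boolean operations.\<close>

lemma cls_in_internal_iff:
  assumes "x \<in> loeb_seqs n"
  shows "cls x \<in> internal_set \<omega> n A \<longleftrightarrow> eventually (\<lambda>k. x k \<in> A k) \<omega>"
proof
  assume "cls x \<in> internal_set \<omega> n A"
  then obtain y where "y \<in> cls x" "eventually (\<lambda>k. y k \<in> A k) \<omega>"
    by (auto simp: internal_set_def)
  then have "eventually (\<lambda>k. x k = y k) \<omega>" by (simp only: mem_cls)
  with \<open>eventually (\<lambda>k. y k \<in> A k) \<omega>\<close> show "eventually (\<lambda>k. x k \<in> A k) \<omega>"
    by eventually_elim simp
next
  assume "eventually (\<lambda>k. x k \<in> A k) \<omega>"
  then show "cls x \<in> internal_set \<omega> n A"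
    using assms cls_in_points cls_self unfolding internal_set_def by blast
qed

lemma internal_subset_points: "internal_set \<omega> n A \<subseteq> loeb_points \<omega> n"
  by (auto simp: internal_set_def)

lemma points_eqI:
  assumes "S \<subseteq> loeb_points \<omega> n" "T \<subseteq> loeb_points \<omega> n"
    and "\<And>x. x \<in> loeb_seqs n \<Longrightarrow> cls x \<in> S \<longleftrightarrow> cls x \<in> T"
  shows "S = T"
  using assms by (blast elim: loeb_points_cases)

lemma internal_Int: "internal_set \<omega> n (\<lambda>k. A k \<inter> B k) = internal_set \<omega> n A \<inter> internal_set \<omega> n B"
  by (rule points_eqI) (auto simp: cls_in_internal_iff eventually_conj_iff
      dest: subsetD[OF internal_subset_points])

lemma internal_Un: "internal_set \<omega> n (\<lambda>k. A k \<union> B k) = internal_set \<omega> n A \<union> internal_set \<omega> n B"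
  by (rule points_eqI) (auto simp: cls_in_internal_iff eventually_disj_iff
      dest: subsetD[OF internal_subset_points])

lemma internal_Diff: "internal_set \<omega> n (\<lambda>k. A k - B k) = internal_set \<omega> n A - internal_set \<omega> n B"
  by (rule points_eqI) (auto simp: cls_in_internal_iff eventually_conj_iff eventually_not_iff
      dest: subsetD[OF internal_subset_points])

lemma internal_restrict: "internal_set \<omega> n (\<lambda>k. A k \<inter> {1..n k}) = internal_set \<omega> n A"
  by (rule points_eqI) (auto simp: cls_in_internal_iff loeb_seqs_iff
      dest: subsetD[OF internal_subset_points])

lemma internal_UNIV: "internal_set \<omega> n (\<lambda>k. UNIV) = loeb_points \<omega> n"
  by (rule points_eqI) (simp_all add: cls_in_internal_iff cls_in_points internal_subset_points)

lemma internal_empty: "internal_set \<omega> n (\<lambda>k. {}) = {}"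
  by (rule points_eqI) (simp_all add: cls_in_internal_iff internal_subset_points)

lemma internal_mem_algebra: "internal_set \<omega> n A \<in> loeb_algebra \<omega> n"
  unfolding loeb_algebra_def by (subst internal_restrict[symmetric]) blast

text \<open>Coordinates of points lie in \<open>{1..n k}\<close>, so cutting a family down to these
  intervals does not change its internal set. From here on families may be arbitrary sets of
  naturals.\<close>

lemma loeb_algebra_eq: "loeb_algebra \<omega> n = range (internal_set \<omega> n)"
  using internal_mem_algebra by (auto simp: loeb_algebra_def)

text \<open>Diagonal choice: x k satisfies the longest prefix of constraints that is jointly
  satisfiable in \<open>{1..n k}\<close>, among prefixes ending at some m \<le> k. The cap makes a
  longest one exist, and it is harmless because k \<ge> m holds eventually along \<omega>.\<close>

lemma saturation:
  fixes A :: "nat \<Rightarrow> nat \<Rightarrow> nat set"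
  assumes "\<And>m. eventually (\<lambda>k. \<exists>i\<in>{1..n k}. \<forall>j\<le>m. i \<in> A j k) \<omega>"
  shows "\<exists>x\<in>loeb_seqs n. \<forall>m. eventually (\<lambda>k. x k \<in> A m k) \<omega>"
proof -
  define Q where "Q k m \<longleftrightarrow> (\<exists>i\<in>{1..n k}. \<forall>j\<le>m. i \<in> A j k)" for k m :: nat
  have "\<exists>i\<in>{1..n k}. \<forall>m\<le>k. Q k m \<longrightarrow> i \<in> A m k" for k
  proof (cases "\<exists>m\<le>k. Q k m")
    case True
    define M where "M = Max {m. m \<le> k \<and> Q k m}"
    have fin: "finite {m. m \<le> k \<and> Q k m}" by simp
    have "M \<in> {m. m \<le> k \<and> Q k m}"
      unfolding M_def using True by (intro Max_in fin) auto
    then obtain i where "i \<in> {1..n k}" "\<forall>j\<le>M. i \<in> A j k" by (auto simp: Q_def)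
    moreover have "m \<le> M" if "m \<le> k" "Q k m" for m
      unfolding M_def using that by (intro Max_ge fin) auto
    ultimately show ?thesis by blast
  next
    case False
    \<comment> \<open>At this index no prefix is satisfiable, so any element serves as default; 1 is
      in range since n k \<ge> 1.\<close>
    with pos[of k] show ?thesis by (intro bexI[of _ 1]) auto
  qed
  then obtain x where x: "\<And>k. x k \<in> {1..n k}" "\<And>k m. m \<le> k \<Longrightarrow> Q k m \<Longrightarrow> x k \<in> A m k"
    by metis
  have "eventually (\<lambda>k. x k \<in> A m k) \<omega>" for m
    using assms[of m, folded Q_def] eventually_ge_ultra[of m]
    by eventually_elim (rule x(2))
  with x(1) show ?thesis by (intro bexI[of _ x]) (auto simp: loeb_seqs_iff)
qed

text \<open>If the inclusion of traces fails, it fails for \<omega>-most k, and saturation for the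
  constant family \<open>A k - B k\<close> assembles the witnesses into a point of the difference.
  So an internal set determines the traces of its family at \<omega>-most k.\<close>

lemma internal_subset_iff:
  "internal_set \<omega> n A \<subseteq> internal_set \<omega> n B \<longleftrightarrow> eventually (\<lambda>k. A k \<inter> {1..n k} \<subseteq> B k) \<omega>"
proof
  assume sub: "internal_set \<omega> n A \<subseteq> internal_set \<omega> n B"
  show "eventually (\<lambda>k. A k \<inter> {1..n k} \<subseteq> B k) \<omega>"
  proof (rule ccontr)
    assume "\<not> ?thesis"
    then have "eventually (\<lambda>k. \<not> A k \<inter> {1..n k} \<subseteq> B k) \<omega>"
      by (simp add: eventually_not_iff)
    then have "eventually (\<lambda>k. \<exists>i\<in>{1..n k}. \<forall>j\<le>m. i \<in> A k - B k) \<omega>" for m :: nat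
      by eventually_elim auto
    then obtain x where x: "x \<in> loeb_seqs n" "eventually (\<lambda>k. x k \<in> A k - B k) \<omega>"
      using saturation[of "\<lambda>_ k. A k - B k"] by blast
    then have "cls x \<in> internal_set \<omega> n A - internal_set \<omega> n B"
      unfolding internal_Diff[symmetric] by (simp add: cls_in_internal_iff)
    with sub show False by blast
  qed
next
  assume ev: "eventually (\<lambda>k. A k \<inter> {1..n k} \<subseteq> B k) \<omega>"
  show "internal_set \<omega> n A \<subseteq> internal_set \<omega> n B"
  proof
    fix c assume c: "c \<in> internal_set \<omega> n A"
    then obtain x where x: "x \<in> loeb_seqs n" "c = cls x"
      using internal_subset_points by (blast elim: loeb_points_cases)
    with c have "eventually (\<lambda>k. x k \<in> A k) \<omega>" by (simp add: cls_in_internal_iff)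
    with ev have "eventually (\<lambda>k. x k \<in> B k) \<omega>"
      by eventually_elim (use x in \<open>auto simp: loeb_seqs_iff\<close>)
    with x show "c \<in> internal_set \<omega> n B" by (simp add: cls_in_internal_iff)
  qed
qed

section \<open>Counting density and the pre-measure on internal sets\<close>

definition freq :: "nat \<Rightarrow> nat set \<Rightarrow> real" where
  "freq k B = real (card (B \<inter> {1..n k})) / real (n k)"

definition dens :: "(nat \<Rightarrow> nat set) \<Rightarrow> real" where
  "dens A = Lim \<omega> (\<lambda>k. freq k (A k))"

lemma n_pos [simp]: "0 < n k"
  using pos[of k] by linarith

lemma freq_bounds: "freq k B \<in> {0..1}"
proof -
  have "card (B \<inter> {1..n k}) \<le> card {1..n k}" by (rule card_mono) auto
  then show ?thesis by (simp add: freq_def)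
qed

lemma freq_mono: "A \<inter> {1..n k} \<subseteq> B \<Longrightarrow> freq k A \<le> freq k B"
  unfolding freq_def by (intro divide_right_mono of_nat_mono card_mono) auto

lemma freq_Un_disjoint:
  assumes "A \<inter> B \<inter> {1..n k} = {}"
  shows "freq k (A \<union> B) = freq k A + freq k B"
proof -
  have "card ((A \<union> B) \<inter> {1..n k}) = card (A \<inter> {1..n k}) + card (B \<inter> {1..n k})"
    unfolding Int_Un_distrib2 using assms by (intro card_Un_disjoint) auto
  then show ?thesis by (simp add: freq_def add_divide_distrib)
qed

lemma tendsto_dens: "((\<lambda>k. freq k (A k)) \<longlongrightarrow> dens A) \<omega>"
  and dens_bounds: "dens A \<in> {0..1}"
  unfolding dens_def by (rule tendsto_Lim_ultra[OF freq_bounds])+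

lemma dens_eqI: "((\<lambda>k. freq k (A k)) \<longlongrightarrow> r) \<omega> \<Longrightarrow> dens A = r"
  unfolding dens_def by (simp add: tendsto_Lim)

lemma dens_le:
  assumes "((\<lambda>k. g k) \<longlongrightarrow> r) \<omega>" "eventually (\<lambda>k. freq k (A k) \<le> g k) \<omega>"
  shows "dens A \<le> r"
  using tendsto_le[OF ultra_ne_bot assms(1) tendsto_dens assms(2)] .

lemma dens_mono:
  assumes "eventually (\<lambda>k. A k \<inter> {1..n k} \<subseteq> B k) \<omega>"
  shows "dens A \<le> dens B"
  by (rule dens_le[OF tendsto_dens], use assms in eventually_elim) (rule freq_mono)

lemma dens_Un_disjoint:
  assumes "eventually (\<lambda>k. A k \<inter> B k \<inter> {1..n k} = {}) \<omega>"
  shows "dens (\<lambda>k. A k \<union> B k) = dens A + dens B"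
proof (rule dens_eqI)
  have "eventually (\<lambda>k. freq k (A k) + freq k (B k) = freq k (A k \<union> B k)) \<omega>"
    using assms by eventually_elim (simp add: freq_Un_disjoint)
  then show "((\<lambda>k. freq k (A k \<union> B k)) \<longlongrightarrow> dens A + dens B) \<omega>"
    by (rule Lim_transform_eventually[OF tendsto_add[OF tendsto_dens tendsto_dens]])
qed

lemma dens_empty: "eventually (\<lambda>k. A k \<inter> {1..n k} = {}) \<omega> \<Longrightarrow> dens A = 0"
  by (rule dens_eqI) (auto simp: freq_def elim: eventually_mono intro!: tendsto_eventually)

lemma dens_UNIV: "dens (\<lambda>k. UNIV) = 1"
  by (rule dens_eqI) (simp add: freq_def less_imp_neq[OF n_pos, symmetric] del: n_pos)

text \<open>The description by \<open>THE\<close> is legitimate because two families with the same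
  internal set have equal traces at \<omega>-most k, hence equal densities.\<close>

lemma loeb_premeasure_internal: "loeb_premeasure \<omega> n (internal_set \<omega> n A) = ennreal (dens A)"
proof -
  have "(THE r. \<exists>B. (\<forall>k. B k \<subseteq> {1..n k}) \<and> internal_set \<omega> n A = internal_set \<omega> n B \<and>
                ((\<lambda>k. real (card (B k)) / real (n k)) \<longlongrightarrow> r) \<omega>) = dens A"
  proof (rule the_equality)
    show "\<exists>B. (\<forall>k. B k \<subseteq> {1..n k}) \<and> internal_set \<omega> n A = internal_set \<omega> n B \<and>
                ((\<lambda>k. real (card (B k)) / real (n k)) \<longlongrightarrow> dens A) \<omega>"
      by (rule exI[of _ "\<lambda>k. A k \<inter> {1..n k}"])
        (use tendsto_dens[of A] internal_restrict[of A] in \<open>simp add: freq_def\<close>)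
  next
    fix r
    assume "\<exists>B. (\<forall>k. B k \<subseteq> {1..n k}) \<and> internal_set \<omega> n A = internal_set \<omega> n B \<and>
                ((\<lambda>k. real (card (B k)) / real (n k)) \<longlongrightarrow> r) \<omega>"
    then obtain B where B: "\<And>k. B k \<subseteq> {1..n k}" "internal_set \<omega> n A = internal_set \<omega> n B"
      "((\<lambda>k. real (card (B k)) / real (n k)) \<longlongrightarrow> r) \<omega>" by blast
    have "B k \<inter> {1..n k} = B k" for k using B(1)[of k] by blast
    then have "r = dens B" using B(3) by (intro dens_eqI[symmetric]) (simp add: freq_def)
    also have "\<dots> = dens A"
      using B(2) by (intro antisym dens_mono; unfold internal_subset_iff[symmetric]; simp)
    finally show "r = dens A" .
  qed
  then show ?thesis by (simp add: loeb_premeasure_def)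
qed

lemma algebra_loeb: "algebra (loeb_points \<omega> n) (loeb_algebra \<omega> n)"
  unfolding algebra_iff_Un loeb_algebra_eq
proof (intro conjI ballI)
  show "range (internal_set \<omega> n) \<subseteq> Pow (loeb_points \<omega> n)"
    using internal_subset_points by blast
  show "{} \<in> range (internal_set \<omega> n)"
    using internal_empty by (metis rangeI)
  show "loeb_points \<omega> n - a \<in> range (internal_set \<omega> n)" if "a \<in> range (internal_set \<omega> n)" for a
    using that unfolding internal_UNIV[symmetric] by (auto simp: internal_Diff[symmetric])
  show "a \<union> b \<in> range (internal_set \<omega> n)"
    if "a \<in> range (internal_set \<omega> n)" "b \<in> range (internal_set \<omega> n)" for a b
    using that by (auto simp: internal_Un[symmetric])
qed

lemma premeasure_positive: "positive (loeb_algebra \<omega> n) (loeb_premeasure \<omega> n)"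
  unfolding positive_def
  by (subst internal_empty[symmetric]) (simp add: loeb_premeasure_internal dens_empty)

lemma internal_eq_empty_iff:
  "internal_set \<omega> n A = {} \<longleftrightarrow> eventually (\<lambda>k. A k \<inter> {1..n k} = {}) \<omega>"
  using internal_subset_iff[of A "\<lambda>k. {}"] by (simp add: internal_empty)

lemma premeasure_additive: "additive (loeb_algebra \<omega> n) (loeb_premeasure \<omega> n)"
proof (unfold additive_def, intro ballI impI)
  fix a b assume "a \<in> loeb_algebra \<omega> n" "b \<in> loeb_algebra \<omega> n" and disj: "a \<inter> b = {}"
  then obtain A B where AB: "a = internal_set \<omega> n A" "b = internal_set \<omega> n B"
    by (auto simp: loeb_algebra_eq)
  have "dens (\<lambda>k. A k \<union> B k) = dens A + dens B"
    using disj by (intro dens_Un_disjoint) (simp add: AB internal_Int[symmetric] internal_eq_empty_iff)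
  then show "loeb_premeasure \<omega> n (a \<union> b) = loeb_premeasure \<omega> n a + loeb_premeasure \<omega> n b"
    using dens_bounds by (simp add: AB internal_Un[symmetric] loeb_premeasure_internal)
qed

text \<open>By saturation a decreasing sequence of internal sets with empty intersection is eventually
  empty, so the continuity condition of Caratheodory's theorem is trivial.\<close>

lemma premeasure_countably_additive:
  "countably_additive (loeb_algebra \<omega> n) (loeb_premeasure \<omega> n)"
proof -
  interpret algebra "loeb_points \<omega> n" "loeb_algebra \<omega> n" by (rule algebra_loeb)
  show ?thesis
  proof (rule empty_continuous_imp_countably_additive[OF premeasure_positive premeasure_additive])
    show "\<forall>A\<in>loeb_algebra \<omega> n. loeb_premeasure \<omega> n A \<noteq> \<infinity>"
      by (auto simp: loeb_algebra_eq loeb_premeasure_internal)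
    fix S :: "nat \<Rightarrow> (nat \<Rightarrow> nat) set set"
    assume S: "range S \<subseteq> loeb_algebra \<omega> n" "decseq S" "(\<Inter>i. S i) = {}"
    have "\<forall>i. \<exists>B. S i = internal_set \<omega> n B"
      using S(1) by (auto simp: loeb_algebra_eq)
    then obtain B where B: "\<And>i. S i = internal_set \<omega> n (B i)" by metis
    have "\<exists>m. S m = {}"
    proof (rule ccontr)
      assume ne: "\<not> ?thesis"
      have "eventually (\<lambda>k. \<exists>i\<in>{1..n k}. \<forall>j\<le>m. i \<in> B j k) \<omega>" for m
      proof -
        have "eventually (\<lambda>k. B m k \<inter> {1..n k} \<subseteq> B j k) \<omega>" if "j \<le> m" for j
          using S(2) that unfolding internal_subset_iff[symmetric] B[symmetric] decseq_def by blast
        then have "eventually (\<lambda>k. \<forall>j\<in>{..m}. B m k \<inter> {1..n k} \<subseteq> B j k) \<omega>"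
          by (intro eventually_ball_finite) auto
        moreover have "eventually (\<lambda>k. B m k \<inter> {1..n k} \<noteq> {}) \<omega>"
          using ne B[of m] unfolding eventually_not_iff internal_eq_empty_iff[symmetric] by metis
        ultimately show ?thesis by eventually_elim fast
      qed
      then obtain x where "x \<in> loeb_seqs n" "\<And>m. eventually (\<lambda>k. x k \<in> B m k) \<omega>"
        using saturation[of B] by blast
      then have "cls x \<in> (\<Inter>i. S i)" by (simp add: B cls_in_internal_iff)
      with S(3) show False by simp
    qed
    then obtain m where "S m = {}" ..
    then have "S i = {}" if "i \<ge> m" for i
      using S(2) that unfolding decseq_def by blast
    then have "eventually (\<lambda>i. loeb_premeasure \<omega> n (S i) = 0) sequentially"
      using premeasure_positive by (intro eventually_sequentiallyI[of m]) (simp add: positive_def)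
    then show "(\<lambda>i. loeb_premeasure \<omega> n (S i)) \<longlonglongrightarrow> 0" by (rule tendsto_eventually)
  qed
qed

section \<open>The Caratheodory extension and its completion\<close>

definition L0 :: "(nat \<Rightarrow> nat) set measure" where
  "L0 = measure_of (loeb_points \<omega> n) (loeb_algebra \<omega> n)
       (outer_measure (loeb_algebra \<omega> n) (loeb_premeasure \<omega> n))"

abbreviation L :: "(nat \<Rightarrow> nat) set measure" where
  "L \<equiv> loeb_measure \<omega> n"

lemma L_eq: "L = completion L0"
  by (simp add: loeb_measure_def L0_def)

lemma loeb_algebra_Pow: "loeb_algebra \<omega> n \<subseteq> Pow (loeb_points \<omega> n)"
  using algebra_loeb by (simp add: algebra_iff_Un)

text \<open>\<open>measure_of\<close> returns the zero measure unless its function is a measure on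
  the generated sigma-algebra, so this must come before any value of \<open>L0\<close> is computed.
  The outer measure is a measure on the Caratheodory measurable sets (\<open>lambda_system\<close>),
  which contain the internal sets by additivity.\<close>

lemma measure_space_L0:
  "measure_space (loeb_points \<omega> n) (sigma_sets (loeb_points \<omega> n) (loeb_algebra \<omega> n))
     (outer_measure (loeb_algebra \<omega> n) (loeb_premeasure \<omega> n))"
  (is "measure_space ?X (sigma_sets ?X ?M) ?O")
proof -
  interpret algebra ?X ?M by (rule algebra_loeb)
  have inc: "increasing ?M (loeb_premeasure \<omega> n)"
    by (rule additive_increasing[OF premeasure_positive premeasure_additive])
  have ms: "measure_space ?X (lambda_system ?X (Pow ?X) ?O) ?O"
    using sigma_algebra.caratheodory_lemma[OF sigma_algebra_Pow
        outer_measure_space_outer_measure[OF premeasure_positive inc]] .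
  then interpret ls: sigma_algebra ?X "lambda_system ?X (Pow ?X) ?O"
    by (simp add: measure_space_def)
  have "sigma_sets ?X ?M \<subseteq> lambda_system ?X (Pow ?X) ?O"
    by (intro ls.sigma_sets_subset algebra_subset_lambda_system
        premeasure_positive inc premeasure_additive)
  with ms show ?thesis
    by (rule measure_down[OF _ sigma_algebra_sigma_sets[OF loeb_algebra_Pow]])
qed

lemma space_L0: "space L0 = loeb_points \<omega> n"
  unfolding L0_def by (rule space_measure_of[OF loeb_algebra_Pow])

lemma sets_L0: "sets L0 = sigma_sets (loeb_points \<omega> n) (loeb_algebra \<omega> n)"
  unfolding L0_def by (rule sets_measure_of[OF loeb_algebra_Pow])

lemma internal_sets_L0 [measurable]: "internal_set \<omega> n A \<in> sets L0"
  unfolding sets_L0 by (rule sigma_sets.Basic) (rule internal_mem_algebra)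

lemma emeasure_internal0: "emeasure L0 (internal_set \<omega> n A) = ennreal (dens A)"
proof -
  interpret algebra "loeb_points \<omega> n" "loeb_algebra \<omega> n" by (rule algebra_loeb)
  have "emeasure L0 (internal_set \<omega> n A) =
      outer_measure (loeb_algebra \<omega> n) (loeb_premeasure \<omega> n) (internal_set \<omega> n A)"
    using measure_space_L0
    by (intro emeasure_measure_of[OF L0_def loeb_algebra_Pow] internal_sets_L0)
      (auto simp: measure_space_def sets_L0)
  also have "\<dots> = loeb_premeasure \<omega> n (internal_set \<omega> n A)"
    by (rule outer_measure_agrees[OF premeasure_positive premeasure_countably_additive
          internal_mem_algebra])
  finally show ?thesis by (simp add: loeb_premeasure_internal)
qed

lemma space_L: "space L = loeb_points \<omega> n"
  by (simp add: L_eq space_L0)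

lemma internal_sets_L [measurable]: "internal_set \<omega> n A \<in> sets L"
  unfolding L_eq by (intro sets_completionI_sets internal_sets_L0)

lemma emeasure_internal: "emeasure L (internal_set \<omega> n A) = ennreal (dens A)"
  unfolding L_eq by (simp add: emeasure_completion internal_sets_L0 emeasure_internal0)

lemma prob_space_L0: "prob_space L0"
  by (rule prob_spaceI) (simp add: space_L0 internal_UNIV[symmetric] emeasure_internal0 dens_UNIV)

section \<open>The action and the standard part\<close>

lemma points_subsetI:
  assumes "S \<subseteq> loeb_points \<omega> n" "\<And>x. x \<in> loeb_seqs n \<Longrightarrow> cls x \<in> S \<Longrightarrow> cls x \<in> T"
  shows "S \<subseteq> T"
proof
  fix c assume "c \<in> S"
  with assms show "c \<in> T" by (metis loeb_points_cases subsetD)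
qed

section \<open>Sequences of permutations acting on the Loeb space\<close>

lemma carrier_sym_product: "p \<in> carrier (sym_product n) \<longleftrightarrow> (\<forall>k. p k permutes {1..n k})"
  by (auto simp: sym_product_def PiE_iff sym_group_carrier)

lemma mult_sym_product: "p \<otimes>\<^bsub>sym_product n\<^esub> q = (\<lambda>k. p k \<circ> q k)"
  by (simp add: sym_product_def sym_group_mult restrict_UNIV)

lemma one_sym_product: "\<one>\<^bsub>sym_product n\<^esub> = (\<lambda>k. id)"
  by (simp add: sym_product_def sym_group_one restrict_UNIV)

lemma group_sym_product: "group (sym_product n)"
  by (simp add: sym_product_def sym_group_is_group)

lemma inv_sym_product:
  assumes "p \<in> carrier (sym_product n)"
  shows "inv\<^bsub>sym_product n\<^esub> p = (\<lambda>k. inv' (p k))"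
proof (rule group.inv_equality[OF group_sym_product _ assms])
  show "(\<lambda>k. inv' (p k)) \<in> carrier (sym_product n)"
    using assms by (simp add: carrier_sym_product permutes_inv)
  show "(\<lambda>k. inv' (p k)) \<otimes>\<^bsub>sym_product n\<^esub> p = \<one>\<^bsub>sym_product n\<^esub>"
    using assms permutes_inverses(2) by (fastforce simp: carrier_sym_product mult_sym_product one_sym_product)
qed

lemma perm_seq:
  assumes "p \<in> carrier (sym_product n)" "x \<in> loeb_seqs n"
  shows "(\<lambda>k. p k (x k)) \<in> loeb_seqs n"
  using assms permutes_in_image by (fastforce simp: carrier_sym_product loeb_seqs_iff)

text \<open>The union in \<open>loeb_act\<close> runs over equal classes: representatives that agree
  at \<omega>-most k still agree there after \<open>p k\<close> is applied.\<close>

lemma act_cls: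
  assumes "p \<in> carrier (sym_product n)" "x \<in> loeb_seqs n"
  shows "loeb_act \<omega> n p (cls x) = cls (\<lambda>k. p k (x k))"
proof -
  have "cls (\<lambda>k. p k (y k)) = cls (\<lambda>k. p k (x k))" if "y \<in> cls x" for y
  proof -
    from that have y: "y \<in> loeb_seqs n" "eventually (\<lambda>k. x k = y k) \<omega>" by (simp_all only: mem_cls)
    from y(2) have "eventually (\<lambda>k. p k (y k) = p k (x k)) \<omega>" by eventually_elim simp
    then show ?thesis using assms y by (subst cls_eq_iff) (auto intro: perm_seq)
  qed
  then show ?thesis using cls_self[OF assms(2)] unfolding loeb_act_def by blast
qed

lemma act_in_points:
  assumes "p \<in> carrier (sym_product n)" "c \<in> loeb_points \<omega> n"
  shows "loeb_act \<omega> n p c \<in> loeb_points \<omega> n"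
  using assms(2,1) by (elim loeb_points_cases) (simp add: act_cls cls_in_points perm_seq)

lemma act_mult:
  assumes "p \<in> carrier (sym_product n)" "q \<in> carrier (sym_product n)" "c \<in> loeb_points \<omega> n"
  shows "loeb_act \<omega> n (p \<otimes>\<^bsub>sym_product n\<^esub> q) c = loeb_act \<omega> n p (loeb_act \<omega> n q c)"
proof -
  have pq: "p \<otimes>\<^bsub>sym_product n\<^esub> q \<in> carrier (sym_product n)"
    using assms group.is_monoid[OF group_sym_product] by (simp add: monoid.m_closed)
  from assms(3) show ?thesis
  proof (rule loeb_points_cases)
    fix x assume "x \<in> loeb_seqs n" "c = cls x"
    then show ?thesis
      using assms pq by (simp add: act_cls perm_seq) (simp add: mult_sym_product)
  qed
qed

lemma act_one: "c \<in> loeb_points \<omega> n \<Longrightarrow> loeb_act \<omega> n \<one>\<^bsub>sym_product n\<^esub> c = c"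
  by (erule loeb_points_cases, simp, subst act_cls)
    (auto simp: one_sym_product carrier_sym_product permutes_id)

lemma act_vimage_internal:
  assumes "p \<in> carrier (sym_product n)"
  shows "loeb_act \<omega> n p -` internal_set \<omega> n A \<inter> loeb_points \<omega> n = internal_set \<omega> n (\<lambda>k. p k -` A k)"
  by (rule points_eqI)
    (use assms in \<open>simp_all add: internal_subset_points act_cls perm_seq cls_in_internal_iff cls_in_points\<close>)

lemma freq_permutes:
  assumes "q permutes {1..n k}"
  shows "freq k (q -` A) = freq k A"
proof -
  have "bij_betw q (q -` A \<inter> {1..n k}) (A \<inter> {1..n k})"
  proof (rule bij_betw_imageI)
    show "inj_on q (q -` A \<inter> {1..n k})" using assms by (rule permutes_inj_on)
    have "q ` (q -` A \<inter> {1..n k}) = A \<inter> q ` {1..n k}" by auto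
    then show "q ` (q -` A \<inter> {1..n k}) = A \<inter> {1..n k}" using permutes_image[OF assms] by simp
  qed
  then show ?thesis by (simp add: freq_def bij_betw_same_card)
qed

lemma act_measurable0:
  assumes "p \<in> carrier (sym_product n)"
  shows "loeb_act \<omega> n p \<in> measurable L0 L0"
proof (rule measurable_sigma_sets[OF sets_L0 loeb_algebra_Pow])
  show "loeb_act \<omega> n p \<in> space L0 \<rightarrow> loeb_points \<omega> n"
    using assms by (auto simp: space_L0 act_in_points)
  fix S assume "S \<in> loeb_algebra \<omega> n"
  then show "loeb_act \<omega> n p -` S \<inter> space L0 \<in> sets L0"
    using assms by (auto simp: loeb_algebra_eq space_L0 act_vimage_internal)
qed

text \<open>The internal sets are stable under intersection and generate the sigma-algebra, so the
  two measures need only be compared on them; there each \<open>p k\<close> preserves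
  cardinality.\<close>

lemma distr_act0:
  assumes p: "p \<in> carrier (sym_product n)"
  shows "distr L0 L0 (loeb_act \<omega> n p) = L0"
proof (rule measure_eqI_generator_eq[where E = "loeb_algebra \<omega> n" and \<Omega> = "loeb_points \<omega> n"
        and A = "\<lambda>_. loeb_points \<omega> n"])
  interpret algebra "loeb_points \<omega> n" "loeb_algebra \<omega> n" by (rule algebra_loeb)
  interpret prob_space L0 by (rule prob_space_L0)
  show "Int_stable (loeb_algebra \<omega> n)" by (auto simp: Int_stable_def)
  show "loeb_algebra \<omega> n \<subseteq> Pow (loeb_points \<omega> n)" by (rule loeb_algebra_Pow)
  show eq: "emeasure (distr L0 L0 (loeb_act \<omega> n p)) S = emeasure L0 S" if "S \<in> loeb_algebra \<omega> n" for S
  proof -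
    from that obtain A where S: "S = internal_set \<omega> n A" by (auto simp: loeb_algebra_eq)
    have "dens (\<lambda>k. p k -` A k) = dens A"
      unfolding dens_def using p by (simp add: freq_permutes carrier_sym_product)
    then show ?thesis
      using p by (simp add: S emeasure_distr act_measurable0 internal_sets_L0 space_L0
          act_vimage_internal emeasure_internal0)
  qed
  show "sets (distr L0 L0 (loeb_act \<omega> n p)) = sigma_sets (loeb_points \<omega> n) (loeb_algebra \<omega> n)"
    "sets L0 = sigma_sets (loeb_points \<omega> n) (loeb_algebra \<omega> n)"
    by (simp_all add: sets_L0)
  show "range (\<lambda>_. loeb_points \<omega> n) \<subseteq> loeb_algebra \<omega> n" by auto
  show "(\<Union>i::nat. loeb_points \<omega> n) = loeb_points \<omega> n" by simp
  show "emeasure (distr L0 L0 (loeb_act \<omega> n p)) (loeb_points \<omega> n) \<noteq> \<infinity>"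
    using eq[OF top] emeasure_space_1 by (simp add: space_L0)
qed

lemma AE_act:
  assumes p: "p \<in> carrier (sym_product n)" and Q: "AE c in L. Q c"
  shows "AE c in L. Q (loeb_act \<omega> n p c)"
proof -
  have "AE c in distr L0 L0 (loeb_act \<omega> n p). Q c"
    using Q unfolding distr_act0[OF p] L_eq AE_completion_iff .
  then have "AE c in L0. Q (loeb_act \<omega> n p c)"
    by (rule AE_distrD[OF act_measurable0[OF p]])
  then show ?thesis unfolding L_eq AE_completion_iff .
qed

section \<open>The standard part and its distribution\<close>

abbreviation st :: "(nat \<Rightarrow> nat) set \<Rightarrow> real" where
  "st \<equiv> standard_part \<omega> n"

lemma coord_bounds: "x \<in> loeb_seqs n \<Longrightarrow> real (x k) / real (n k) \<in> {0..1}"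
  by (auto simp: loeb_seqs_iff divide_le_eq_1)

lemma standard_part_eqI:
  assumes "x \<in> loeb_seqs n" "((\<lambda>k. real (x k) / real (n k)) \<longlongrightarrow> r) \<omega>"
  shows "st (cls x) = r"
  unfolding standard_part_def
proof (rule the_equality)
  show "\<exists>x\<in>cls x. ((\<lambda>k. real (x k) / real (n k)) \<longlongrightarrow> r) \<omega>"
    using assms cls_self by blast
  fix r' assume "\<exists>x\<in>cls x. ((\<lambda>k. real (x k) / real (n k)) \<longlongrightarrow> r') \<omega>"
  then obtain y where y: "y \<in> cls x" "((\<lambda>k. real (y k) / real (n k)) \<longlongrightarrow> r') \<omega>" by blast
  from y(1) have "eventually (\<lambda>k. x k = y k) \<omega>" by (simp only: mem_cls)
  then have "eventually (\<lambda>k. real (y k) / real (n k) = real (x k) / real (n k)) \<omega>"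
    by eventually_elim simp
  with y(2) have "((\<lambda>k. real (x k) / real (n k)) \<longlongrightarrow> r') \<omega>"
    by (rule Lim_transform_eventually)
  with assms(2) show "r' = r" using tendsto_unique[OF ultra_ne_bot] by blast
qed

lemma standard_part_tendsto:
  assumes "x \<in> loeb_seqs n"
  shows "((\<lambda>k. real (x k) / real (n k)) \<longlongrightarrow> st (cls x)) \<omega>" "st (cls x) \<in> {0..1}"
proof -
  note lim = tendsto_Lim_ultra[of "\<lambda>k. real (x k) / real (n k)" 0 1, OF coord_bounds[OF assms]]
  from lim standard_part_eqI[OF assms lim(1)]
  show "((\<lambda>k. real (x k) / real (n k)) \<longlongrightarrow> st (cls x)) \<omega>" "st (cls x) \<in> {0..1}" by simp_all
qed

lemma standard_part_bounds: "c \<in> loeb_points \<omega> n \<Longrightarrow> st c \<in> {0..1}"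
  using standard_part_tendsto(2) by (blast elim: loeb_points_cases)

lemma n_filterlim: "filterlim (\<lambda>k. real (n k)) at_top \<omega>"
  by (rule filterlim_mono[OF _ order_refl ultra_le_sequentially])
    (rule filterlim_compose[OF filterlim_real_sequentially filterlim_subseq[OF mono]])

lemma inverse_n_tendsto: "((\<lambda>k. 1 / real (n k)) \<longlongrightarrow> 0) \<omega>"
  by (rule real_tendsto_divide_at_top[OF tendsto_const n_filterlim])

text \<open>The counted trace is \<open>{1..nat \<lfloor>b * real (n k)\<rfloor>}\<close>, so its
  frequency is within 1 / n k of b.\<close>

lemma dens_initial:
  assumes "b \<in> {0..1}"
  shows "dens (\<lambda>k. {i. real i / real (n k) \<le> b}) = b"
proof (rule dens_eqI, rule tendsto_sandwich)
  have freq: "freq k {i. real i / real (n k) \<le> b} = real_of_int \<lfloor>b * real (n k)\<rfloor> / real (n k)" for k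
  proof -
    have fl: "0 \<le> \<lfloor>b * real (n k)\<rfloor>" using assms by simp
    have "b * real (n k) \<le> real (n k)" using assms by (simp add: mult_le_cancel_right1)
    then have le: "\<lfloor>b * real (n k)\<rfloor> \<le> int (n k)" unfolding floor_le_iff by linarith
    have "{i. real i / real (n k) \<le> b} \<inter> {1..n k} = {1..nat \<lfloor>b * real (n k)\<rfloor>}"
    proof (rule Set.set_eqI)
      fix i
      have "real i / real (n k) \<le> b \<longleftrightarrow> int i \<le> \<lfloor>b * real (n k)\<rfloor>"
        by (simp add: le_floor_iff divide_le_eq)
      then show "i \<in> {i. real i / real (n k) \<le> b} \<inter> {1..n k} \<longleftrightarrow> i \<in> {1..nat \<lfloor>b * real (n k)\<rfloor>}"
        using fl le by auto
    qed
    then show ?thesis using fl by (simp add: freq_def)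
  qed
  have "b - 1 / real (n k) \<le> freq k {i. real i / real (n k) \<le> b}" for k
  proof -
    have "b * real (n k) - 1 \<le> real_of_int \<lfloor>b * real (n k)\<rfloor>" by linarith
    then have "(b * real (n k) - 1) / real (n k) \<le> real_of_int \<lfloor>b * real (n k)\<rfloor> / real (n k)"
      by (rule divide_right_mono) simp
    then show ?thesis unfolding freq by (simp add: diff_divide_distrib)
  qed
  then show "\<forall>\<^sub>F k in \<omega>. b - 1 / real (n k) \<le> freq k {i. real i / real (n k) \<le> b}" by simp
  have "freq k {i. real i / real (n k) \<le> b} \<le> b" for k
    unfolding freq by (simp add: divide_le_eq)
  then show "\<forall>\<^sub>F k in \<omega>. freq k {i. real i / real (n k) \<le> b} \<le> b" by simp
  show "((\<lambda>k. b - 1 / real (n k)) \<longlongrightarrow> b) \<omega>"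
    using tendsto_diff[OF tendsto_const inverse_n_tendsto, of b] by simp
qed (rule tendsto_const)

lemma standard_part_less_internal:
  assumes "x \<in> loeb_seqs n" "st (cls x) < b"
  shows "cls x \<in> internal_set \<omega> n (\<lambda>k. {i. real i / real (n k) \<le> b})"
proof -
  have "eventually (\<lambda>k. real (x k) / real (n k) < b) \<omega>"
    using standard_part_tendsto(1)[OF assms(1)] assms(2) by (rule order_tendstoD)
  then have "eventually (\<lambda>k. x k \<in> {i. real i / real (n k) \<le> b}) \<omega>" by eventually_elim simp
  then show ?thesis using assms(1) by (simp add: cls_in_internal_iff)
qed

lemma internal_standard_part_le:
  assumes "x \<in> loeb_seqs n" "cls x \<in> internal_set \<omega> n (\<lambda>k. {i. real i / real (n k) \<le> b})"
  shows "st (cls x) \<le> b"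
  using assms standard_part_tendsto(1)[OF assms(1)]
  by (intro tendsto_upperbound[OF _ _ ultra_ne_bot]) (auto simp: cls_in_internal_iff)

text \<open>No single internal condition describes the left side, since x k / n k may exceed its
  limit. A strict bound on the limit passes to the coordinates and a weak bound on the coordinates
  passes back, so a is approached from above.\<close>

lemma standard_part_le_eq:
  "{c \<in> loeb_points \<omega> n. st c \<le> a} =
     (\<Inter>m. internal_set \<omega> n (\<lambda>k. {i. real i / real (n k) \<le> a + inverse (real (Suc m))}))"
    (is "_ = (\<Inter>m. ?I m)")
proof (rule points_eqI)
  show "(\<Inter>m. ?I m) \<subseteq> loeb_points \<omega> n" using internal_subset_points by blast
  fix x assume x: "x \<in> loeb_seqs n"
  show "cls x \<in> {c \<in> loeb_points \<omega> n. st c \<le> a} \<longleftrightarrow> cls x \<in> (\<Inter>m. ?I m)"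
  proof
    assume "cls x \<in> {c \<in> loeb_points \<omega> n. st c \<le> a}"
    then have "st (cls x) < a + inverse (real (Suc m))" for m
      by (auto intro: le_less_trans)
    then show "cls x \<in> (\<Inter>m. ?I m)" using standard_part_less_internal[OF x] by blast
  next
    assume "cls x \<in> (\<Inter>m. ?I m)"
    then have "st (cls x) \<le> a + inverse (real (Suc m))" for m
      using internal_standard_part_le[OF x] by blast
    then have "st (cls x) \<le> a"
      by (intro tendsto_lowerbound[OF LIMSEQ_inverse_real_of_nat_add[of a] _ sequentially_bot]) auto
    then show "cls x \<in> {c \<in> loeb_points \<omega> n. st c \<le> a}" using cls_in_points[OF x] by simp
  qed
qed auto

lemma standard_part_measurable0: "st \<in> borel_measurable L0"
  unfolding borel_measurable_iff_le space_L0 standard_part_le_eq by auto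

lemma measure_standard_part_le:
  assumes a: "a \<in> {0..1}"
  shows "measure L0 {c \<in> loeb_points \<omega> n. st c \<le> a} = a"
proof -
  interpret prob_space L0 by (rule prob_space_L0)
  let ?S = "{c \<in> loeb_points \<omega> n. st c \<le> a}"
  let ?I = "\<lambda>b. internal_set \<omega> n (\<lambda>k. {i. real i / real (n k) \<le> b})"
  have S: "?S \<in> sets L0" unfolding standard_part_le_eq by auto
  have I: "measure L0 (?I b) = b" if "b \<in> {0..1}" for b
    using that by (simp add: measure_def emeasure_internal0 dens_initial)
  have "?I a \<subseteq> ?S"
    by (rule points_subsetI[OF internal_subset_points])
      (simp add: internal_standard_part_le cls_in_points)
  then have "a \<le> measure L0 ?S"
    using I[OF a] finite_measure_mono[OF \<open>?I a \<subseteq> ?S\<close> S] by simp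
  moreover have "measure L0 ?S \<le> a"
  \<comment> \<open>The comparison sets need b between a and 1, as \<open>dens_initial\<close>
    covers only [0,1]; for a = 1 the total mass is the bound.\<close>
  proof (cases "a = 1")
    case False
    show ?thesis
    proof (rule dense_ge_bounded[of a 1])
      show "a < 1" using a False by simp
      fix b assume b: "a < b" "b < 1"
      have "?S \<subseteq> ?I b"
        by (rule points_subsetI) (use b(1) in \<open>auto intro!: standard_part_less_internal\<close>)
      then have "measure L0 ?S \<le> measure L0 (?I b)"
        by (rule finite_measure_mono[OF _ internal_sets_L0])
      also have "\<dots> = b" using I[of b] a b by simp
      finally show "measure L0 ?S \<le> b" .
    qed
  qed simp
  ultimately show ?thesis by simp
qed

text \<open>A probability distribution on the line is determined by its values on half-lines, which
  \<open>measure_standard_part_le\<close> supplies.\<close>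

lemma distr_standard_part0: "distr L0 borel st = uniform_measure lborel {0..1}"
proof (rule cdf_unique)
  interpret prob_space L0 by (rule prob_space_L0)
  show "real_distribution (distr L0 borel st)"
    using standard_part_measurable0 by (rule real_distribution_distr)
  interpret U: prob_space "uniform_measure lborel {0..1::real}"
    by (rule prob_space_uniform_measure) auto
  show "real_distribution (uniform_measure lborel {0..1::real})"
    by unfold_locales auto
  show "cdf (distr L0 borel st) = cdf (uniform_measure lborel {0..1})"
  proof
    fix a :: real
    have "measure L0 {c \<in> loeb_points \<omega> n. st c \<le> a} = measure lborel ({0..1} \<inter> {..a})"
    proof -
      consider "a < 0" | "a \<in> {0..1}" | "a > 1" by fastforce
      then show ?thesis
      proof cases
        case 1
        then have e: "{c \<in> loeb_points \<omega> n. st c \<le> a} = {}" "{0..1} \<inter> {..a} = {}"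
          using standard_part_bounds by fastforce+
        show ?thesis unfolding e by simp
      next
        case 2
        then have "{0..1} \<inter> {..a} = {0..a}" by auto
        with 2 show ?thesis by (simp add: measure_standard_part_le)
      next
        case 3
        then have "{c \<in> loeb_points \<omega> n. st c \<le> a} = space L0" "{0..1} \<inter> {..a} = {0..1}"
          using standard_part_bounds by (fastforce simp: space_L0)+
        then show ?thesis using prob_space by simp
      qed
    qed
    then show "cdf (distr L0 borel st) a = cdf (uniform_measure lborel {0..1}) a"
      using standard_part_measurable0
      by (simp add: cdf_def measure_distr space_L0 vimage_def Int_def conj_commute)
  qed
qed

lemma emeasure_standard_part0:
  assumes "B \<in> sets borel"
  shows "emeasure L0 (st -` B \<inter> loeb_points \<omega> n) = emeasure lborel ({0..1} \<inter> B)"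
  using assms arg_cong[OF distr_standard_part0, of "\<lambda>M. emeasure M B"] standard_part_measurable0
  by (simp add: emeasure_distr space_L0 divide_ennreal_def)

text \<open>A Lebesgue set is a Borel set together with a subset of a Borel null set. The preimage
  of that subset lies in a null set of \<open>L0\<close>, and it is the completion that makes it
  measurable.\<close>

lemma standard_part_vimage:
  assumes "E \<in> sets unit_interval"
  shows "st -` E \<inter> loeb_points \<omega> n \<in> sets L"
    and "emeasure L (st -` E \<inter> loeb_points \<omega> n) = emeasure unit_interval E"
proof -
  from assms have E: "E \<in> sets lebesgue" "E \<subseteq> {0..1}" by (auto simp: sets_restrict_space_iff)
  then obtain S N N' where SN: "E = S \<union> N" "N \<subseteq> N'" "N' \<in> null_sets lborel" "S \<in> sets lborel"
    by (auto elim: sets_completionE)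
  have "emeasure lborel ({0..1} \<inter> N') = 0"
    using SN(3) by (intro emeasure_eq_0[OF _ _ Int_lower2]) auto
  then have "st -` N' \<inter> loeb_points \<omega> n \<in> null_sets L0"
    using SN(3) measurable_sets[OF standard_part_measurable0, of N']
    by (auto simp: null_sets_def emeasure_standard_part0 space_L0)
  then have N: "st -` N \<inter> loeb_points \<omega> n \<in> null_sets L"
    unfolding L_eq
    by (intro null_sets_completion_subset[OF _ null_sets_completionI[of "st -` N' \<inter> loeb_points \<omega> n"]])
      (use SN(2) in auto)
  have S: "st -` S \<inter> loeb_points \<omega> n \<in> sets L0"
    using SN(4) measurable_sets[OF standard_part_measurable0, of S] by (simp add: space_L0)
  have eq: "st -` E \<inter> loeb_points \<omega> n = (st -` S \<inter> loeb_points \<omega> n) \<union> (st -` N \<inter> loeb_points \<omega> n)"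
    using SN(1) by auto
  show "st -` E \<inter> loeb_points \<omega> n \<in> sets L"
    unfolding eq by (rule sets.Un[OF _ null_setsD2[OF N]]) (simp add: L_eq S)
  have "emeasure L (st -` E \<inter> loeb_points \<omega> n) = emeasure L (st -` S \<inter> loeb_points \<omega> n)"
    unfolding eq using S N by (intro emeasure_Un_null_set) (auto simp: L_eq)
  also have "\<dots> = emeasure lborel ({0..1} \<inter> S)"
    using S SN(4) by (simp add: L_eq emeasure_standard_part0)
  also have "{0..1} \<inter> S = S" using SN(1) E(2) by auto
  also have "emeasure lborel S = emeasure lebesgue S" using SN(4) by simp
  also have "\<dots> = emeasure lebesgue E"
    unfolding SN(1)
    using SN null_sets_completion_subset[OF SN(2) null_sets_completionI[OF SN(3)]]
    by (intro emeasure_Un_null_set[symmetric] sets_completionI_sets)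
  finally show "emeasure L (st -` E \<inter> loeb_points \<omega> n) = emeasure unit_interval E"
    using E by (simp add: emeasure_restrict_space)
qed

lemma standard_part_measurable: "st \<in> measurable L unit_interval"
  using standard_part_bounds standard_part_vimage(1) by (auto intro!: measurableI simp: space_L)

lemma distr_standard_part: "distr L unit_interval st = unit_interval"
  by (rule measure_eqI) (simp_all add: emeasure_distr standard_part_measurable space_L standard_part_vimage(2))

lemma AE_standard_part: "AE r in unit_interval. P r \<Longrightarrow> AE c in L. P (st c)"
  by (rule AE_distrD[OF standard_part_measurable]) (simp only: distr_standard_part)

lemma AE_standard_partD:
  assumes "AE c in L. P (st c)" "{r \<in> {0..1}. P r} \<in> sets unit_interval"
  shows "AE r in unit_interval. P r"
proof -
  have "{r \<in> space unit_interval. P r} \<in> sets unit_interval" using assms(2) by simp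
  from AE_distr_iff[OF standard_part_measurable this] assms(1) show ?thesis
    unfolding distr_standard_part by simp
qed

end

section \<open>Automorphism classes and the group GA\<close>

lemma distr_measure_preserving:
  assumes "f \<in> measure_preserving_maps M"
  shows "distr M M f = M"
  using assms by (intro measure_eqI) (auto simp: measure_preserving_maps_def emeasure_distr)

text \<open>Preimages of null sets are null. This permits substituting a map into an identity that
  holds only almost everywhere, and so makes composition of classes well defined.\<close>

lemma AE_measure_preserving:
  assumes f: "f \<in> measure_preserving_maps M" and P: "AE x in M. P x"
  shows "AE x in M. P (f x)"
  using f P by (intro AE_distrD[of f M M P])
    (simp_all only: distr_measure_preserving, simp add: measure_preserving_maps_def)

lemma measure_preserving_comp:
  assumes f: "f \<in> measure_preserving_maps M" and g: "g \<in> measure_preserving_maps M"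
  shows "f \<circ> g \<in> measure_preserving_maps M"
proof -
  have fg: "f \<in> measurable M M" "g \<in> measurable M M"
    using f g by (auto simp: measure_preserving_maps_def)
  have "emeasure M ((f \<circ> g) -` A \<inter> space M) = emeasure M A" if A: "A \<in> sets M" for A
  proof -
    have "(f \<circ> g) -` A \<inter> space M = g -` (f -` A \<inter> space M) \<inter> space M"
      using measurable_space[OF fg(2)] by auto
    then show ?thesis
      using f g A measurable_sets[OF fg(1) A] by (auto simp: measure_preserving_maps_def)
  qed
  then show ?thesis
    using measurable_comp[OF fg(2,1)] by (auto simp: measure_preserving_maps_def)
qed

lemma id_measure_preserving: "id \<in> measure_preserving_maps M"
  by (auto simp: measure_preserving_maps_def intro!: arg_cong[where f = "emeasure M"] dest: sets.sets_into_space)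

lemma automorphisms_mp: "f \<in> automorphisms M \<Longrightarrow> f \<in> measure_preserving_maps M"
  by (simp add: automorphisms_def)

lemma id_automorphism: "id \<in> automorphisms M"
  using id_measure_preserving unfolding automorphisms_def by (auto intro!: bexI[of _ id])

lemma automorphism_comp:
  assumes "f \<in> automorphisms M" "g \<in> automorphisms M"
  shows "f \<circ> g \<in> automorphisms M"
proof -
  obtain f' where f': "f' \<in> measure_preserving_maps M" "AE x in M. f' (f x) = x" "AE x in M. f (f' x) = x"
    using assms(1) by (auto simp: automorphisms_def)
  obtain g' where g': "g' \<in> measure_preserving_maps M" "AE x in M. g' (g x) = x" "AE x in M. g (g' x) = x"
    using assms(2) by (auto simp: automorphisms_def)
  have f: "f \<in> measure_preserving_maps M" and g: "g \<in> measure_preserving_maps M"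
    using assms by (simp_all add: automorphisms_mp)
  have "AE x in M. (g' \<circ> f') ((f \<circ> g) x) = x"
    using AE_measure_preserving[OF g f'(2)] g'(2) by eventually_elim simp
  moreover have "AE x in M. (f \<circ> g) ((g' \<circ> f') x) = x"
    using AE_measure_preserving[OF f'(1) g'(3)] f'(3) by eventually_elim simp
  ultimately show ?thesis
    using measure_preserving_comp[OF f g] measure_preserving_comp[OF g'(1) f'(1)]
    unfolding automorphisms_def by blast
qed

lemma equiv_ae_rel: "equiv (automorphisms M) (ae_rel M)"
proof (rule equivI)
  show "ae_rel M \<subseteq> automorphisms M \<times> automorphisms M" by (auto simp: ae_rel_def)
  show "refl_on (automorphisms M) (ae_rel M)" by (auto simp: ae_rel_def refl_on_def)
  show "sym (ae_rel M)" by (auto simp: ae_rel_def sym_def eq_commute)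
  show "trans (ae_rel M)"
  proof (rule transI)
    fix f g h assume "(f, g) \<in> ae_rel M" "(g, h) \<in> ae_rel M"
    then have fgh: "f \<in> automorphisms M" "h \<in> automorphisms M" "AE x in M. f x = g x" "AE x in M. g x = h x"
      by (auto simp: ae_rel_def)
    from fgh(3,4) have "AE x in M. f x = h x" by eventually_elim simp
    with fgh show "(f, h) \<in> ae_rel M" by (simp add: ae_rel_def)
  qed
qed

lemma ae_rel_comp:
  assumes "(f, f') \<in> ae_rel M" "(g, g') \<in> ae_rel M"
  shows "(f \<circ> g, f' \<circ> g') \<in> ae_rel M"
proof -
  have *: "f \<in> automorphisms M" "f' \<in> automorphisms M" "g \<in> automorphisms M" "g' \<in> automorphisms M"
    "AE x in M. f x = f' x" "AE x in M. g x = g' x"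
    using assms by (auto simp: ae_rel_def)
  have "AE x in M. (f \<circ> g) x = (f' \<circ> g') x"
    using AE_measure_preserving[OF automorphisms_mp[OF *(3)] *(5)] *(6)
    by eventually_elim simp
  then show ?thesis using * by (simp add: ae_rel_def automorphism_comp)
qed

lemma Aut_mult:
  assumes "f \<in> automorphisms M" "g \<in> automorphisms M"
  shows "ae_rel M `` {f} \<otimes>\<^bsub>Aut_group M\<^esub> ae_rel M `` {g} = ae_rel M `` {f \<circ> g}"
proof -
  have "ae_rel M `` {f' \<circ> g'} = ae_rel M `` {f \<circ> g}" if "f' \<in> ae_rel M `` {f}" "g' \<in> ae_rel M `` {g}" for f' g'
    using that ae_rel_comp[of f f' M g g'] equiv_class_eq[OF equiv_ae_rel] by fastforce
  moreover have "f \<in> ae_rel M `` {f}" "g \<in> ae_rel M `` {g}"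
    using assms equiv_class_self[OF equiv_ae_rel] by auto
  ultimately have "(\<Union>f'\<in>ae_rel M `` {f}. \<Union>g'\<in>ae_rel M `` {g}. ae_rel M `` {f' \<circ> g'}) = ae_rel M `` {f \<circ> g}"
    by blast
  then show ?thesis by (simp add: Aut_group_def)
qed

lemma Aut_carrier: "f \<in> automorphisms M \<Longrightarrow> ae_rel M `` {f} \<in> carrier (Aut_group M)"
  by (simp add: Aut_group_def quotientI)

lemma Aut_carrier_cases:
  assumes "C \<in> carrier (Aut_group M)"
  obtains f where "f \<in> automorphisms M" "C = ae_rel M `` {f}"
  using assms by (auto simp: Aut_group_def elim: quotientE)

lemma group_Aut: "group (Aut_group M)"
proof (rule groupI)
  have one: "\<one>\<^bsub>Aut_group M\<^esub> = ae_rel M `` {id}" by (simp add: Aut_group_def)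
  show "\<one>\<^bsub>Aut_group M\<^esub> \<in> carrier (Aut_group M)"
    unfolding one by (rule Aut_carrier[OF id_automorphism])
  show "x \<otimes>\<^bsub>Aut_group M\<^esub> y \<in> carrier (Aut_group M)"
    if "x \<in> carrier (Aut_group M)" "y \<in> carrier (Aut_group M)" for x y
    using that by (elim Aut_carrier_cases) (simp add: Aut_mult automorphism_comp Aut_carrier)
  show "x \<otimes>\<^bsub>Aut_group M\<^esub> y \<otimes>\<^bsub>Aut_group M\<^esub> z = x \<otimes>\<^bsub>Aut_group M\<^esub> (y \<otimes>\<^bsub>Aut_group M\<^esub> z)"
    if "x \<in> carrier (Aut_group M)" "y \<in> carrier (Aut_group M)" "z \<in> carrier (Aut_group M)" for x y z
    using that by (elim Aut_carrier_cases) (simp add: Aut_mult automorphism_comp comp_assoc)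
  show "\<one>\<^bsub>Aut_group M\<^esub> \<otimes>\<^bsub>Aut_group M\<^esub> x = x" if "x \<in> carrier (Aut_group M)" for x
    using that unfolding one by (elim Aut_carrier_cases) (simp add: Aut_mult id_automorphism)
  show "\<exists>y\<in>carrier (Aut_group M). y \<otimes>\<^bsub>Aut_group M\<^esub> x = \<one>\<^bsub>Aut_group M\<^esub>"
    if x: "x \<in> carrier (Aut_group M)" for x
  proof -
    obtain f where f: "f \<in> automorphisms M" "x = ae_rel M `` {f}" using x by (rule Aut_carrier_cases)
    then obtain g where g: "g \<in> measure_preserving_maps M" "AE x in M. g (f x) = x" "AE x in M. f (g x) = x"
      by (auto simp: automorphisms_def)
    \<comment> \<open>The definition of an automorphism is symmetric in a map and its almost
      everywhere inverse.\<close>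
    with f have ga: "g \<in> automorphisms M" by (auto simp: automorphisms_def)
    have "(g \<circ> f, id) \<in> ae_rel M"
      using g(2) f(1) ga by (simp add: ae_rel_def automorphism_comp id_automorphism)
    then have "ae_rel M `` {g \<circ> f} = ae_rel M `` {id}" by (rule equiv_class_eq[OF equiv_ae_rel])
    with f ga show ?thesis
      by (intro bexI[of _ "ae_rel M `` {g}"]) (simp_all add: Aut_mult Aut_carrier one)
  qed
qed

context loeb
begin

section \<open>Sequences of vanishing Hamming length and the quotient\<close>

lemma dens_Un_le: "dens (\<lambda>k. A k \<union> B k) \<le> dens A + dens B"
proof (rule dens_le[OF tendsto_add[OF tendsto_dens tendsto_dens]], intro always_eventually allI)
  fix k
  have "freq k (A k \<union> B k) = freq k (A k) + freq k (B k - A k)"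
    by (subst freq_Un_disjoint[symmetric]) auto
  also have "freq k (B k - A k) \<le> freq k (B k)" by (rule freq_mono) auto
  finally show "freq k (A k \<union> B k) \<le> freq k (A k) + freq k (B k)" by simp
qed

lemma dens_Un_null: "dens A = 0 \<Longrightarrow> dens B = 0 \<Longrightarrow> dens (\<lambda>k. A k \<union> B k) = 0"
  using dens_Un_le[of A B] dens_bounds[of "\<lambda>k. A k \<union> B k"] by simp

lemma dens_null_mono:
  assumes "dens B = 0" "\<And>k. A k \<subseteq> B k"
  shows "dens A = 0"
proof -
  have "dens A \<le> dens B" by (intro dens_mono always_eventually) (use assms(2) in auto)
  with assms(1) dens_bounds[of A] show ?thesis by simp
qed

lemma hamming_null_iff:
  "p \<in> hamming_null \<omega> n \<longleftrightarrow> p \<in> carrier (sym_product n) \<and> dens (\<lambda>k. {i. p k i \<noteq> i}) = 0"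
proof -
  have "hamming_length (n k) (p k) = freq k {i. p k i \<noteq> i}" for k
    by (simp add: hamming_length_def freq_def Int_def conj_commute)
  then show ?thesis
    using dens_eqI[of "\<lambda>k. {i. p k i \<noteq> i}" 0] tendsto_dens[of "\<lambda>k. {i. p k i \<noteq> i}"]
    by (auto simp: hamming_null_def)
qed

text \<open>Everything is read off the sets of moved points: an inverse moves the same points, a
  product moves at most the union, and a conjugate moves a preimage under a permutation, which has
  the same density.\<close>

lemma normal_hamming_null: "hamming_null \<omega> n \<lhd> sym_product n"
proof -
  interpret G: group "sym_product n" by (rule group_sym_product)
  have "subgroup (hamming_null \<omega> n) (sym_product n)"
  proof (rule G.subgroupI)
    show "hamming_null \<omega> n \<subseteq> carrier (sym_product n)" by (auto simp: hamming_null_def)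
    have "\<one>\<^bsub>sym_product n\<^esub> \<in> hamming_null \<omega> n"
      unfolding hamming_null_iff by (simp add: one_sym_product dens_empty) (simp add: one_sym_product[symmetric])
    then show "hamming_null \<omega> n \<noteq> {}" by blast
    show "inv\<^bsub>sym_product n\<^esub> p \<in> hamming_null \<omega> n" if p: "p \<in> hamming_null \<omega> n" for p
    proof -
      from p have pc: "p \<in> carrier (sym_product n)" by (simp add: hamming_null_iff)
      then have perm: "p k permutes {1..n k}" for k by (simp add: carrier_sym_product)
      have "{i. inv' (p k) i \<noteq> i} = {i. p k i \<noteq> i}" for k
        using permutes_inv_eq[OF perm[of k]] by (auto simp: eq_commute)
      with p pc G.inv_closed[OF pc] show ?thesis by (simp add: hamming_null_iff inv_sym_product)
    qed
    show "p \<otimes>\<^bsub>sym_product n\<^esub> q \<in> hamming_null \<omega> n"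
      if "p \<in> hamming_null \<omega> n" "q \<in> hamming_null \<omega> n" for p q
    proof -
      have "dens (\<lambda>k. {i. p k i \<noteq> i} \<union> {i. q k i \<noteq> i}) = 0"
        using that by (intro dens_Un_null) (simp_all add: hamming_null_iff)
      then have "dens (\<lambda>k. {i. (p k \<circ> q k) i \<noteq> i}) = 0" by (rule dens_null_mono) auto
      with that G.m_closed[of p q] show ?thesis by (simp add: hamming_null_iff mult_sym_product)
    qed
  qed
  moreover have "x \<otimes>\<^bsub>sym_product n\<^esub> h \<otimes>\<^bsub>sym_product n\<^esub> inv\<^bsub>sym_product n\<^esub> x \<in> hamming_null \<omega> n"
    if x: "x \<in> carrier (sym_product n)" and h: "h \<in> hamming_null \<omega> n" for x h
  proof -
    from x have perm: "x k permutes {1..n k}" for k by (simp add: carrier_sym_product)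
    have eq: "{i. (x k \<circ> h k \<circ> inv' (x k)) i \<noteq> i} = inv' (x k) -` {i. h k i \<noteq> i}" for k
      using permutes_inv_eq[OF perm[of k]] by (auto simp: eq_commute)
    have "dens (\<lambda>k. {i. (x k \<circ> h k \<circ> inv' (x k)) i \<noteq> i}) = dens (\<lambda>k. {i. h k i \<noteq> i})"
      unfolding dens_def by (simp only: eq freq_permutes[OF permutes_inv[OF perm]])
    moreover have "x \<otimes>\<^bsub>sym_product n\<^esub> h \<otimes>\<^bsub>sym_product n\<^esub> inv\<^bsub>sym_product n\<^esub> x \<in> carrier (sym_product n)"
      using x h by (intro G.m_closed G.inv_closed) (simp_all add: hamming_null_iff)
    ultimately show ?thesis
      using h x by (simp add: hamming_null_iff mult_sym_product inv_sym_product)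
  qed
  ultimately show ?thesis by (simp add: G.normal_inv_iff)
qed

abbreviation sofic_class :: "(nat \<Rightarrow> nat \<Rightarrow> nat) \<Rightarrow> (nat \<Rightarrow> nat \<Rightarrow> nat) set" where
  "sofic_class p \<equiv> hamming_null \<omega> n #>\<^bsub>sym_product n\<^esub> p"

lemma group_sofic: "group (sofic_group \<omega> n)"
  unfolding sofic_group_def by (rule normal.factorgroup_is_group[OF normal_hamming_null])

lemma cos_group_hom: "group_hom (sym_product n) (sofic_group \<omega> n) sofic_class"
  unfolding group_hom_def group_hom_axioms_def
  using group_sofic group_sym_product normal.r_coset_hom_Mod[OF normal_hamming_null]
  by (simp add: sofic_group_def)

lemma sofic_cases:
  assumes "P \<in> carrier (sofic_group \<omega> n)"
  obtains p where "p \<in> carrier (sym_product n)" "P = sofic_class p"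
  using assms by (auto simp: sofic_group_def FactGroup_def RCOSETS_def)

lemma cos_self: "p \<in> carrier (sym_product n) \<Longrightarrow> p \<in> sofic_class p"
  using group.rcos_self[OF group_sym_product] normal_imp_subgroup[OF normal_hamming_null] by blast

section \<open>Restriction to the standard part, on representatives and on cosets\<close>

lemma AE_internal_null:
  assumes "dens A = 0"
  shows "AE c in L. c \<notin> internal_set \<omega> n A"
  by (rule AE_not_in) (simp add: null_sets_def emeasure_internal assms internal_sets_L)

text \<open>Write q as h times p with h of vanishing Hamming length. Outside the internal set of
  points moved by h, which is null, h acts trivially; \<open>AE_act\<close> carries this along
  p.\<close>

lemma AE_act_cong:
  assumes p: "p \<in> carrier (sym_product n)" and q: "q \<in> sofic_class p"
  shows "AE c in L. loeb_act \<omega> n q c = loeb_act \<omega> n p c"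
proof -
  from q obtain h where h: "h \<in> hamming_null \<omega> n" "q = h \<otimes>\<^bsub>sym_product n\<^esub> p"
    by (auto simp: r_coset_def)
  then have hc: "h \<in> carrier (sym_product n)" "dens (\<lambda>k. {i. h k i \<noteq> i}) = 0"
    by (simp_all add: hamming_null_iff)
  have "AE c in L. loeb_act \<omega> n h c = c"
    using AE_internal_null[OF hc(2)] AE_space
  proof eventually_elim
    case (elim c)
    then obtain x where x: "x \<in> loeb_seqs n" "c = cls x" by (auto simp: space_L elim: loeb_points_cases)
    with elim(1) have "eventually (\<lambda>k. h k (x k) = x k) \<omega>"
      by (simp add: cls_in_internal_iff eventually_not_iff)
    with x hc(1) show ?case by (simp only: act_cls cls_eq_iff perm_seq)
  qed
  from AE_act[OF p this] AE_space show ?thesis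
    by eventually_elim (simp add: h(2) act_mult hc(1) p space_L)
qed

text \<open>The relation \<open>restricts_to\<close> for one representative and without its range
  condition, so that products and inverses can be computed in \<open>sym_product n\<close>.\<close>

definition lift :: "(nat \<Rightarrow> nat \<Rightarrow> nat) \<Rightarrow> (real \<Rightarrow> real) \<Rightarrow> bool" where
  "lift p \<phi> \<longleftrightarrow> (AE c in L. st (loeb_act \<omega> n p c) = \<phi> (st c))"

lemma restricts_to_cos_iff:
  assumes p: "p \<in> carrier (sym_product n)"
  shows "restricts_to \<omega> n (sofic_class p) \<phi> \<longleftrightarrow> \<phi> \<in> {0..1} \<rightarrow> {0..1} \<and> lift p \<phi>"
proof -
  have "lift q \<phi>" if "lift p \<phi>" "q \<in> sofic_class p" for q
    using that(1) AE_act_cong[OF p that(2)] unfolding lift_def by eventually_elim simp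
  then show ?thesis
    unfolding restricts_to_def lift_def[symmetric] using cos_self[OF p] by blast
qed

lemma automorphism_funcset: "\<phi> \<in> automorphisms unit_interval \<Longrightarrow> \<phi> \<in> {0..1} \<rightarrow> {0..1}"
  by (drule automorphisms_mp) (auto simp: measure_preserving_maps_def measurable_def)

lemma restricts_to_aut_iff:
  assumes "p \<in> carrier (sym_product n)" "\<phi> \<in> automorphisms unit_interval"
  shows "restricts_to \<omega> n (sofic_class p) \<phi> \<longleftrightarrow> lift p \<phi>"
  using assms by (simp add: restricts_to_cos_iff automorphism_funcset)

lemma lift_mult:
  assumes "p \<in> carrier (sym_product n)" "q \<in> carrier (sym_product n)" "lift p \<phi>" "lift q \<psi>"
  shows "lift (p \<otimes>\<^bsub>sym_product n\<^esub> q) (\<phi> \<circ> \<psi>)"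
  using AE_act[OF assms(2) assms(3)[unfolded lift_def]] assms(4)[unfolded lift_def] AE_space
  unfolding lift_def by eventually_elim (simp add: space_L act_mult assms)

lemma lift_one: "lift \<one>\<^bsub>sym_product n\<^esub> id"
  unfolding lift_def using AE_space by eventually_elim (simp add: space_L act_one)

text \<open>With q the inverse sequence, the relation for p at the point q c reads st c = \<phi> (st
  (q c)), and applying \<psi> leaves st (q c). Both exceptional sets are pulled back along
  q.\<close>

lemma lift_inv:
  assumes p: "p \<in> carrier (sym_product n)" "lift p \<phi>" and \<psi>: "AE r in unit_interval. \<psi> (\<phi> r) = r"
  shows "lift (inv\<^bsub>sym_product n\<^esub> p) \<psi>"
proof -
  interpret G: group "sym_product n" by (rule group_sym_product)
  let ?q = "inv\<^bsub>sym_product n\<^esub> p"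
  have q: "?q \<in> carrier (sym_product n)" using p by simp
  show ?thesis
    unfolding lift_def
    using AE_act[OF q p(2)[unfolded lift_def]] AE_act[OF q AE_standard_part[OF \<psi>]] AE_space
  proof eventually_elim
    case (elim c)
    then have "loeb_act \<omega> n p (loeb_act \<omega> n ?q c) = c"
      using p q by (simp add: act_mult[symmetric] space_L act_one)
    with elim show ?case by simp
  qed
qed

lemma automorphism_borel_measurable:
  assumes "\<phi> \<in> automorphisms unit_interval"
  shows "\<phi> \<in> borel_measurable unit_interval"
proof -
  have "\<phi> \<in> measurable unit_interval unit_interval"
    using automorphisms_mp[OF assms] by (simp add: measure_preserving_maps_def)
  \<comment> \<open>The inclusion coarsens the target from Lebesgue to Borel sets, which equality
    sets and integration require.\<close>
  moreover have "(\<lambda>x. x) \<in> measurable unit_interval borel"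
    by (intro measurable_restrict_space1 measurable_completion) simp
  ultimately have "(\<lambda>x. x) \<circ> \<phi> \<in> measurable unit_interval borel" by (rule measurable_comp)
  then show ?thesis by (simp add: o_def)
qed

text \<open>Both functions agree almost everywhere after composition with st, and st preserves
  measure.\<close>

lemma lift_unique:
  assumes "lift p \<phi>" "lift p \<psi>" "\<phi> \<in> automorphisms unit_interval" "\<psi> \<in> automorphisms unit_interval"
  shows "AE r in unit_interval. \<phi> r = \<psi> r"
proof (rule AE_standard_partD)
  show "AE c in L. \<phi> (st c) = \<psi> (st c)"
    using assms(1,2) unfolding lift_def by eventually_elim simp
  have "{r \<in> space unit_interval. \<phi> r = \<psi> r} \<in> sets unit_interval"
    by (rule borel_measurable_eq[OF assms(3,4)[THEN automorphism_borel_measurable]])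
  then show "{r \<in> {0..1}. \<phi> r = \<psi> r} \<in> sets unit_interval" by simp
qed

lemma lift_cong:
  assumes "lift p \<phi>" "AE r in unit_interval. \<phi> r = \<psi> r"
  shows "lift p \<psi>"
  using assms(1) AE_standard_part[OF assms(2)] unfolding lift_def by eventually_elim simp

text \<open>Lifts are unique modulo null sets and stable under changes on them, so
  \<open>restriction\<close> collects exactly one whole class and is a genuine element of
  \<open>Aut_group\<close>.\<close>

lemma restriction_cos:
  assumes "p \<in> carrier (sym_product n)" "lift p \<phi>" "\<phi> \<in> automorphisms unit_interval"
  shows "restriction \<omega> n (sofic_class p) = ae_rel unit_interval `` {\<phi>}"
proof (rule Set.set_eqI)
  fix \<psi>
  show "\<psi> \<in> restriction \<omega> n (sofic_class p) \<longleftrightarrow> \<psi> \<in> ae_rel unit_interval `` {\<phi>}"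
    using assms(3) restricts_to_aut_iff[OF assms(1), of \<psi>] lift_unique[OF assms(2) _ assms(3), of \<psi>]
      lift_cong[OF assms(2), of \<psi>]
    unfolding restriction_def ae_rel_def by blast
qed

lemma cos_in_sofic: "p \<in> carrier (sym_product n) \<Longrightarrow> sofic_class p \<in> carrier (sofic_group \<omega> n)"
  using group_hom.hom_closed[OF cos_group_hom] .

lemma GA_I:
  assumes "p \<in> carrier (sym_product n)" "lift p \<phi>" "\<phi> \<in> automorphisms unit_interval"
  shows "sofic_class p \<in> GA \<omega> n"
  using cos_in_sofic[OF assms(1)] restricts_to_aut_iff[OF assms(1,3)] assms(2,3)
  unfolding GA_def by blast

lemma GA_cases:
  assumes "P \<in> GA \<omega> n"
  obtains p \<phi> where "p \<in> carrier (sym_product n)" "P = sofic_class p" "lift p \<phi>" "\<phi> \<in> automorphisms unit_interval"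
proof -
  from assms obtain \<phi> where P: "P \<in> carrier (sofic_group \<omega> n)"
    and \<phi>: "\<phi> \<in> automorphisms unit_interval" "restricts_to \<omega> n P \<phi>"
    unfolding GA_def by blast
  from P obtain p where p: "p \<in> carrier (sym_product n)" "P = sofic_class p" by (rule sofic_cases)
  with \<phi> show thesis using restricts_to_aut_iff by (intro that[of p \<phi>]) simp_all
qed

lemma cos_mult:
  assumes "p \<in> carrier (sym_product n)" "q \<in> carrier (sym_product n)"
  shows "sofic_class p \<otimes>\<^bsub>sofic_group \<omega> n\<^esub> sofic_class q = sofic_class (p \<otimes>\<^bsub>sym_product n\<^esub> q)"
  using group_hom.hom_mult[OF cos_group_hom assms] by simp

lemma subgroup_GA: "subgroup (GA \<omega> n) (sofic_group \<omega> n)"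
proof (rule group.subgroupI[OF group_sofic])
  interpret G: group "sym_product n" by (rule group_sym_product)
  show "GA \<omega> n \<subseteq> carrier (sofic_group \<omega> n)" by (auto simp: GA_def)
  show "GA \<omega> n \<noteq> {}" using GA_I[OF G.one_closed lift_one id_automorphism] by blast
  show "inv\<^bsub>sofic_group \<omega> n\<^esub> P \<in> GA \<omega> n" if "P \<in> GA \<omega> n" for P
    using that
  proof (rule GA_cases)
    fix p \<phi> assume p: "p \<in> carrier (sym_product n)" "P = sofic_class p" "lift p \<phi>" "\<phi> \<in> automorphisms unit_interval"
    then obtain \<psi> where \<psi>: "\<psi> \<in> automorphisms unit_interval" "AE r in unit_interval. \<psi> (\<phi> r) = r"
      by (auto simp: automorphisms_def)
    have "sofic_class (inv\<^bsub>sym_product n\<^esub> p) \<in> GA \<omega> n"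
      by (rule GA_I[OF _ lift_inv[OF p(1,3) \<psi>(2)] \<psi>(1)]) (use p in simp)
    then show ?thesis using group_hom.hom_inv[OF cos_group_hom p(1)] p(2) by simp
  qed
  show "P \<otimes>\<^bsub>sofic_group \<omega> n\<^esub> Q \<in> GA \<omega> n" if "P \<in> GA \<omega> n" "Q \<in> GA \<omega> n" for P Q
    using that by (elim GA_cases)
      (simp add: cos_mult GA_I[OF G.m_closed lift_mult automorphism_comp])
qed

lemma restriction_hom:
  "restriction \<omega> n \<in> hom ((sofic_group \<omega> n)\<lparr>carrier := GA \<omega> n\<rparr>) (Aut_group unit_interval)"
proof (rule homI)
  interpret G: group "sym_product n" by (rule group_sym_product)
  fix P assume "P \<in> carrier ((sofic_group \<omega> n)\<lparr>carrier := GA \<omega> n\<rparr>)"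
  then have "P \<in> GA \<omega> n" by simp
  then obtain p \<phi> where p: "p \<in> carrier (sym_product n)" "P = sofic_class p" "lift p \<phi>" "\<phi> \<in> automorphisms unit_interval"
    by (rule GA_cases)
  then show "restriction \<omega> n P \<in> carrier (Aut_group unit_interval)"
    by (simp add: restriction_cos Aut_carrier)
  fix Q assume "Q \<in> carrier ((sofic_group \<omega> n)\<lparr>carrier := GA \<omega> n\<rparr>)"
  then have "Q \<in> GA \<omega> n" by simp
  then obtain q \<psi> where q: "q \<in> carrier (sym_product n)" "Q = sofic_class q" "lift q \<psi>" "\<psi> \<in> automorphisms unit_interval"
    by (rule GA_cases)
  have "restriction \<omega> n (sofic_class (p \<otimes>\<^bsub>sym_product n\<^esub> q)) = ae_rel unit_interval `` {\<phi> \<circ> \<psi>}"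
    by (rule restriction_cos[OF G.m_closed[OF p(1) q(1)] lift_mult[OF p(1) q(1) p(3) q(3)]
          automorphism_comp[OF p(4) q(4)]])
  then show "restriction \<omega> n (P \<otimes>\<^bsub>(sofic_group \<omega> n)\<lparr>carrier := GA \<omega> n\<rparr>\<^esub> Q) =
      restriction \<omega> n P \<otimes>\<^bsub>Aut_group unit_interval\<^esub> restriction \<omega> n Q"
    unfolding p(2) q(2) restriction_cos[OF p(1,3,4)] restriction_cos[OF q(1,3,4)]
      Aut_mult[OF p(4) q(4)] by (simp add: cos_mult p(1) q(1))
qed

end

section \<open>Inversions, displacement and the kernel\<close>

definition inversions :: "nat \<Rightarrow> (nat \<Rightarrow> nat) \<Rightarrow> (nat \<times> nat) set" where
  "inversions m p = {(i, j). i \<in> {1..m} \<and> j \<in> {1..m} \<and> i < j \<and> p i > p j}"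

definition footrule :: "nat \<Rightarrow> (nat \<Rightarrow> nat) \<Rightarrow> nat" where
  "footrule m p = (\<Sum>i\<in>{1..m}. nat \<bar>int (p i) - int i\<bar>)"

lemma finite_inversions: "finite (inversions m p)"
  by (rule finite_subset[of _ "{1..m} \<times> {1..m}"]) (auto simp: inversions_def)

lemma card_inversions_le: "card (inversions m p) \<le> m * m"
proof -
  have "inversions m p \<subseteq> {1..m} \<times> {1..m}" by (auto simp: inversions_def)
  then have "card (inversions m p) \<le> card ({1..m} \<times> {1..m})" by (intro card_mono) auto
  then show ?thesis by (simp add: card_cartesian_product)
qed

text \<open>An inversion \<open>(i, j)\<close> forces \<open>j - i < \<bar>p i - i\<bar> + \<bar>p j - j\<bar>\<close>, so one of its two
  entries is displaced by at least half of \<open>j - i\<close>.\<close>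

lemma inversions_le_footrule: "card (inversions m p) \<le> 4 * footrule m p"
proof -
  define d where "d i = nat \<bar>int (p i) - int i\<bar>" for i
  let ?A = "SIGMA i:{1..m}. {i<..i + 2 * d i}"
  let ?B = "SIGMA j:{1..m}. {j - 2 * d j..<j}"
  have "inversions m p \<subseteq> ?A \<union> prod.swap ` ?B"
  proof
    fix x assume "x \<in> inversions m p"
    then obtain i j where x: "x = (i, j)" "i \<in> {1..m}" "j \<in> {1..m}" "i < j" "p j < p i"
      by (auto simp: inversions_def)
    show "x \<in> ?A \<union> prod.swap ` ?B"
    proof (cases "j \<le> i + 2 * d i")
      case True
      with x show ?thesis by simp
    next
      case False
      then have "j - 2 * d j \<le> i" using x(4,5) unfolding d_def by linarith
      then have "(j, i) \<in> ?B" using x by simp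
      then show ?thesis using x(1) by force
    qed
  qed
  then have "card (inversions m p) \<le> card (?A \<union> prod.swap ` ?B)"
    by (intro card_mono) auto
  also have "\<dots> \<le> card ?A + card (prod.swap ` ?B)" by (rule card_Un_le)
  also have "card (prod.swap ` ?B) \<le> card ?B" by (rule card_image_le) auto
  also have "card ?A = (\<Sum>i\<in>{1..m}. 2 * d i)" by simp
  \<comment> \<open>Inequality only: \<open>j - 2 * d j\<close> truncates at 0, so these fibres can
    have fewer than \<open>2 * d j\<close> elements.\<close>
  also have "card ?B \<le> (\<Sum>i\<in>{1..m}. 2 * d i)"
    by (subst card_SigmaI) (auto intro!: sum_mono)
  also have "(\<Sum>i\<in>{1..m}. 2 * d i) = 2 * footrule m p"
    by (simp add: footrule_def d_def sum_distrib_left)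
  finally show ?thesis by simp
qed

text \<open>The displacement of \<open>i\<close> is at most the number of inversions in which \<open>i\<close> takes part.\<close>

lemma footrule_le_inversions:
  assumes p: "p permutes {1..m}"
  shows "footrule m p \<le> 2 * card (inversions m p)"
proof -
  define R where "R i = {j \<in> {1..m}. i < j \<and> p j < p i}" for i
  define S where "S i = {j \<in> {1..m}. j < i \<and> p j > p i}" for i
  have inj: "inj_on p A" for A using p by (rule permutes_inj_on)
  have card_vimage: "card {j \<in> {1..m}. p j \<in> B} = card B" if B: "B \<subseteq> {1..m}" for B
  proof -
    have "p ` {j \<in> {1..m}. p j \<in> B} = B"
    proof -
      have "p ` {j \<in> {1..m}. p j \<in> B} = p ` {1..m} \<inter> B" by auto
      then show ?thesis using permutes_image[OF p] B by auto
    qed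
    then show ?thesis using card_image[OF inj] by metis
  qed
  have le: "nat \<bar>int (p i) - int i\<bar> \<le> card (R i) + card (S i)" if i: "i \<in> {1..m}" for i
  proof -
    have pi: "p i \<in> {1..m}" using permutes_in_image[OF p] i by simp
    have "p i - 1 = card {j \<in> {1..m}. p j \<in> {1..<p i}}"
      using pi by (subst card_vimage) auto
    \<comment> \<open>An index whose value is below \<open>p i\<close> either lies left of i, where
      there are i - 1 places, or forms an inversion with i.\<close>
    also have "\<dots> \<le> card ({1..<i} \<union> R i)"
    proof (rule card_mono)
      show "finite ({1..<i} \<union> R i)" by (simp add: R_def)
      show "{j \<in> {1..m}. p j \<in> {1..<p i}} \<subseteq> {1..<i} \<union> R i"
      proof
        fix j assume j: "j \<in> {j \<in> {1..m}. p j \<in> {1..<p i}}"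
        then have "j \<noteq> i" by auto
        then consider "j < i" | "i < j" by linarith
        then show "j \<in> {1..<i} \<union> R i" using j by cases (auto simp: R_def)
      qed
    qed
    also have "\<dots> \<le> (i - 1) + card (R i)" using card_Un_le[of "{1..<i}" "R i"] by simp
    finally have 1: "p i - 1 \<le> (i - 1) + card (R i)" .
    have "m - p i = card {j \<in> {1..m}. p j \<in> {p i<..m}}"
      by (subst card_vimage) auto
    also have "\<dots> \<le> card ({i<..m} \<union> S i)"
    proof (rule card_mono)
      show "finite ({i<..m} \<union> S i)" by (simp add: S_def)
      show "{j \<in> {1..m}. p j \<in> {p i<..m}} \<subseteq> {i<..m} \<union> S i"
      proof
        fix j assume j: "j \<in> {j \<in> {1..m}. p j \<in> {p i<..m}}"
        then have "j \<noteq> i" by auto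
        then consider "j < i" | "i < j" by linarith
        then show "j \<in> {i<..m} \<union> S i" using j by cases (auto simp: S_def)
      qed
    qed
    also have "\<dots> \<le> (m - i) + card (S i)" using card_Un_le[of "{i<..m}" "S i"] by simp
    finally have 2: "m - p i \<le> (m - i) + card (S i)" .
    have "int (p i) - int i \<le> int (card (R i))" "int i - int (p i) \<le> int (card (S i))"
      using 1 2 i pi by simp_all linarith+
    then show ?thesis by linarith
  qed
  have "inversions m p = (SIGMA i:{1..m}. R i)"
    by (auto simp: R_def inversions_def)
  then have R: "(\<Sum>i\<in>{1..m}. card (R i)) = card (inversions m p)"
    using card_SigmaI[of "{1..m}" R] by (simp add: R_def)
  \<comment> \<open>Every inversion is counted by \<open>R\<close> at its smaller index and again by
    \<open>S\<close> at its larger one, whence the factor 2.\<close>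
  have "prod.swap ` inversions m p = (SIGMA i:{1..m}. S i)"
  proof (intro subset_antisym subsetI)
    fix x assume "x \<in> (SIGMA i:{1..m}. S i)"
    then have "prod.swap x \<in> inversions m p" by (cases x) (simp add: S_def inversions_def)
    then show "x \<in> prod.swap ` inversions m p" by (metis image_eqI swap_swap)
  qed (auto simp: S_def inversions_def)
  then have S: "(\<Sum>i\<in>{1..m}. card (S i)) = card (inversions m p)"
    using card_SigmaI[of "{1..m}" S] card_image[of prod.swap "inversions m p"] by (simp add: S_def)
  have "footrule m p \<le> (\<Sum>i\<in>{1..m}. card (R i) + card (S i))"
    unfolding footrule_def by (rule sum_mono) (rule le)
  then show ?thesis by (simp add: sum.distrib R S)
qed

lemma coxeter_length_inversions:
  "coxeter_length m p = 2 * real (card (inversions m p)) / (real m * (real m - 1))"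
  by (simp add: coxeter_length_def inversions_def)

text \<open>For m \<ge> 2 one has m * m \<le> 2 * m * (m - 1); together with the factor 2 in the
  Coxeter length this gives 4.\<close>

lemma coxeter_length_le:
  assumes "m \<ge> 2" "real (card (inversions m p)) \<le> (real m)\<^sup>2 * b"
  shows "coxeter_length m p \<le> 4 * b"
proof -
  have m: "real m \<ge> 2" using assms(1) by simp
  have "0 \<le> (real m)\<^sup>2 * b" using assms(2) by (rule order_trans[rotated]) simp
  then have "0 \<le> b" using m by (simp add: zero_le_mult_iff)
  then have "real m * b * 2 \<le> real m * b * real m" using m by (intro mult_left_mono) auto
  then have "2 * ((real m)\<^sup>2 * b) \<le> 4 * b * (real m * (real m - 1))"
    by (simp add: power2_eq_square algebra_simps)
  with assms(2) have "2 * real (card (inversions m p)) \<le> 4 * b * (real m * (real m - 1))" by linarith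
  then show ?thesis using m unfolding coxeter_length_inversions by (simp add: divide_le_eq)
qed

text \<open>The constant 4 is not sharp; it puts all lengths into one compact interval, so that
  limits along \<omega> exist. For m = 0 and m = 1 the length is 0 by division by zero.\<close>

lemma coxeter_length_bounds: "coxeter_length m p \<in> {0..4}"
proof (cases "m \<ge> 2")
  case True
  have "real (card (inversions m p)) \<le> (real m)\<^sup>2 * 1"
    using card_inversions_le[of m p] by (simp add: power2_eq_square flip: of_nat_mult)
  from coxeter_length_le[OF True this] True show ?thesis
    by (auto simp: coxeter_length_inversions)
next
  case False
  then have "m = 0 \<or> m = 1" by auto
  then show ?thesis by (auto simp: coxeter_length_def)
qed

context loeb
begin

text \<open>Only pairs with an entry in the set D of disagreement can change status, at most 2 *
  card D * n k of them. Normalising multiplies by 2 / (n k * (n k - 1)), which is at most 4 / (n k *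
  n k); hence the 8.\<close>

lemma coxeter_length_cong_le:
  assumes "n k \<ge> 2"
  shows "coxeter_length (n k) p \<le> coxeter_length (n k) q + 8 * freq k {i. p i \<noteq> q i}"
proof -
  let ?D = "{i. p i \<noteq> q i} \<inter> {1..n k}"
  have "inversions (n k) p \<subseteq> inversions (n k) q \<union> (?D \<times> {1..n k} \<union> {1..n k} \<times> ?D)"
    by (auto simp: inversions_def)
  then have "card (inversions (n k) p) \<le> card (inversions (n k) q \<union> (?D \<times> {1..n k} \<union> {1..n k} \<times> ?D))"
    by (intro card_mono) (auto simp: finite_inversions)
  also have "\<dots> \<le> card (inversions (n k) q) + (card (?D \<times> {1..n k}) + card ({1..n k} \<times> ?D))"
    by (intro order_trans[OF card_Un_le] add_left_mono card_Un_le)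
  finally have "card (inversions (n k) p) \<le> card (inversions (n k) q) + 2 * (card ?D * n k)"
    by (simp add: card_cartesian_product mult.commute)
  then have I: "real (card (inversions (n k) p)) \<le> real (card (inversions (n k) q)) + 2 * (real (card ?D) * real (n k))"
    by (drule_tac of_nat_mono[where 'a = real]) simp
  have n: "real (n k) \<ge> 2" using assms by simp
  then have nn: "real (n k) * (real (n k) - 1) > 0" by simp
  have "real (card ?D) * 2 \<le> real (card ?D) * real (n k)" using n by (intro mult_left_mono) auto
  then have "real (card ?D) * real (n k) * real (n k) \<le> 2 * real (card ?D) * (real (n k) * (real (n k) - 1))"
    using mult_right_mono[of "real (card ?D) * 2" "real (card ?D) * real (n k)" "real (n k)"]
    by (simp add: algebra_simps)
  then have "real (card ?D) * real (n k) / (real (n k) * (real (n k) - 1)) \<le> 2 * freq k {i. p i \<noteq> q i}"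
    using n by (simp add: freq_def field_simps)
  moreover have "coxeter_length (n k) p \<le>
      2 * (real (card (inversions (n k) q)) + 2 * (real (card ?D) * real (n k))) / (real (n k) * (real (n k) - 1))"
    unfolding coxeter_length_inversions using I nn by (intro divide_right_mono mult_left_mono) auto
  moreover have "\<dots> = coxeter_length (n k) q + 4 * (real (card ?D) * real (n k) / (real (n k) * (real (n k) - 1)))"
    unfolding coxeter_length_inversions by (simp add: add_divide_distrib distrib_left)
  ultimately show ?thesis by linarith
qed

lemma eventually_n_ge: "eventually (\<lambda>k. n k \<ge> N) \<omega>"
proof (rule eventually_mono[OF eventually_ge_ultra[of N]])
  show "N \<le> n k" if "N \<le> k" for k using that index_gt[of k] by linarith
qed

section \<open>The Coxeter length on the sofic group and infinitesimal displacement\<close>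

definition cox :: "(nat \<Rightarrow> nat \<Rightarrow> nat) \<Rightarrow> real" where
  "cox p = Lim \<omega> (\<lambda>k. coxeter_length (n k) (p k))"

lemma tendsto_cox: "((\<lambda>k. coxeter_length (n k) (p k)) \<longlongrightarrow> cox p) \<omega>"
  unfolding cox_def by (rule tendsto_Lim_ultra[OF coxeter_length_bounds])

lemma cox_cong_le:
  assumes "dens (\<lambda>k. {i. p k i \<noteq> q k i}) = 0"
  shows "cox p \<le> cox q"
proof -
  have "((\<lambda>k. coxeter_length (n k) (q k) + 8 * freq k {i. p k i \<noteq> q k i}) \<longlongrightarrow> cox q + 8 * 0) \<omega>"
    using tendsto_dens[of "\<lambda>k. {i. p k i \<noteq> q k i}"] unfolding assms
    by (intro tendsto_add tendsto_mult tendsto_cox tendsto_const)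
  moreover have "\<forall>\<^sub>F k in \<omega>. coxeter_length (n k) (p k) \<le> coxeter_length (n k) (q k) + 8 * freq k {i. p k i \<noteq> q k i}"
    using eventually_n_ge[of 2] by eventually_elim (rule coxeter_length_cong_le)
  ultimately show ?thesis using tendsto_le[OF ultra_ne_bot _ tendsto_cox] by fastforce
qed

text \<open>With q equal to h times p, the two sequences differ exactly on the preimage under
  \<open>p k\<close> of the points moved by h, a set of density 0, and \<open>cox_cong_le\<close>
  applies in both directions.\<close>

lemma cox_cos:
  assumes p: "p \<in> carrier (sym_product n)" and q: "q \<in> sofic_class p"
  shows "cox q = cox p"
proof -
  from q obtain h where h: "h \<in> hamming_null \<omega> n" "q = h \<otimes>\<^bsub>sym_product n\<^esub> p"
    by (auto simp: r_coset_def)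
  have eq: "{i. q k i \<noteq> p k i} = p k -` {i. h k i \<noteq> i}" for k
    by (auto simp: h(2) mult_sym_product)
  from p have perm: "p k permutes {1..n k}" for k by (simp add: carrier_sym_product)
  have "dens (\<lambda>k. {i. q k i \<noteq> p k i}) = dens (\<lambda>k. {i. h k i \<noteq> i})"
    unfolding dens_def by (simp only: eq freq_permutes[OF perm])
  then have 0: "dens (\<lambda>k. {i. q k i \<noteq> p k i}) = 0" using h(1) by (simp add: hamming_null_iff)
  have "{i. p k i \<noteq> q k i} = {i. q k i \<noteq> p k i}" for k by auto
  with 0 have "dens (\<lambda>k. {i. p k i \<noteq> q k i}) = 0" by simp
  with 0 show ?thesis by (simp add: antisym cox_cong_le)
qed

lemma sofic_coxeter_length_cos:
  assumes p: "p \<in> carrier (sym_product n)"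
  shows "sofic_coxeter_length \<omega> n (sofic_class p) = cox p"
  unfolding sofic_coxeter_length_def
proof (rule the_equality)
  show "\<exists>q\<in>sofic_class p. ((\<lambda>k. coxeter_length (n k) (q k)) \<longlongrightarrow> cox p) \<omega>"
    using tendsto_cox cos_self[OF p] by blast
  fix r assume "\<exists>q\<in>sofic_class p. ((\<lambda>k. coxeter_length (n k) (q k)) \<longlongrightarrow> r) \<omega>"
  then obtain q where q: "q \<in> sofic_class p" "((\<lambda>k. coxeter_length (n k) (q k)) \<longlongrightarrow> r) \<omega>" by blast
  with tendsto_unique[OF ultra_ne_bot q(2) tendsto_cox] cox_cos[OF p] show "r = cox p" by simp
qed

definition displaced :: "real \<Rightarrow> (nat \<Rightarrow> nat \<Rightarrow> nat) \<Rightarrow> nat \<Rightarrow> nat set" where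
  "displaced e p k = {i. \<bar>real (p k i) - real i\<bar> \<ge> e * real (n k)}"

lemma footrule_real: "real (footrule m p) = (\<Sum>i\<in>{1..m}. \<bar>real (p i) - real i\<bar>)"
proof -
  have "real (nat \<bar>int a - int b\<bar>) = \<bar>real a - real b\<bar>" for a b by linarith
  then show ?thesis by (simp add: footrule_def)
qed

text \<open>Markov's inequality for the displacement: each counted point contributes at least e * n
  k to the footrule, which is at most twice the number of inversions.\<close>

lemma displaced_freq_le:
  assumes p: "p k permutes {1..n k}" and e: "e > 0" and that: "n k \<ge> 2"
  shows "freq k (displaced e p k) \<le> coxeter_length (n k) (p k) / e"
proof -
  let ?A = "displaced e p k \<inter> {1..n k}"
  have "real (card ?A) * (e * real (n k)) = (\<Sum>i\<in>?A. e * real (n k))" by simp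
  also have "\<dots> \<le> (\<Sum>i\<in>?A. \<bar>real (p k i) - real i\<bar>)"
    by (rule sum_mono) (auto simp: displaced_def)
  also have "\<dots> \<le> (\<Sum>i\<in>{1..n k}. \<bar>real (p k i) - real i\<bar>)" by (rule sum_mono2) auto
  also have "\<dots> \<le> 2 * real (card (inversions (n k) (p k)))"
    using of_nat_mono[OF footrule_le_inversions[OF p], where 'a = real]
    unfolding footrule_real[symmetric] by simp
  finally have *: "real (card ?A) * (e * real (n k)) \<le> 2 * real (card (inversions (n k) (p k)))" .
  have n: "real (n k) \<ge> 2" using that by simp
  have "freq k (displaced e p k) = real (card ?A) * (e * real (n k)) / (e * (real (n k) * real (n k)))"
    using e n by (simp add: freq_def)
  also have "\<dots> \<le> 2 * real (card (inversions (n k) (p k))) / (e * (real (n k) * real (n k)))"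
    using * e n by (intro divide_right_mono) auto
  also have "\<dots> \<le> 2 * real (card (inversions (n k) (p k))) / (e * (real (n k) * (real (n k) - 1)))"
    using e n by (intro divide_left_mono mult_left_mono mult_pos_pos) auto
  also have "\<dots> = coxeter_length (n k) (p k) / e"
    by (simp add: coxeter_length_inversions field_simps)
  finally show ?thesis .
qed

text \<open>Points outside the displaced set contribute at most e * n k each to the footrule, the
  others at most n k. The 16 is the 4 of \<open>inversions_le_footrule\<close> times the 4 of
  \<open>coxeter_length_le\<close>.\<close>

lemma coxeter_length_displaced_le:
  assumes p: "p k permutes {1..n k}" and e: "e > 0" and n: "n k \<ge> 2"
  shows "coxeter_length (n k) (p k) \<le> 16 * (e + freq k (displaced e p k))"
proof -
  let ?A = "displaced e p k \<inter> {1..n k}"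
  have pi: "p k i \<in> {1..n k}" if "i \<in> {1..n k}" for i using permutes_in_image[OF p] that by simp
  have "real (footrule (n k) (p k)) =
      (\<Sum>i\<in>{1..n k} - ?A. \<bar>real (p k i) - real i\<bar>) + (\<Sum>i\<in>?A. \<bar>real (p k i) - real i\<bar>)"
    unfolding footrule_real by (rule sum.subset_diff) auto
  also have "\<dots> \<le> real (card ({1..n k} - ?A)) * (e * real (n k)) + real (card ?A) * real (n k)"
  proof (intro add_mono sum_bounded_above)
    show "\<bar>real (p k i) - real i\<bar> \<le> e * real (n k)" if "i \<in> {1..n k} - ?A" for i
      using that by (auto simp: displaced_def)
    show "\<bar>real (p k i) - real i\<bar> \<le> real (n k)" if "i \<in> ?A" for i
      using that pi[of i] by auto
  qed
  also have "real (card ({1..n k} - ?A)) \<le> real (n k)"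
    using card_mono[of "{1..n k}" "{1..n k} - ?A"] by simp
  also have "real (card ?A) = freq k (displaced e p k) * real (n k)" by (simp add: freq_def)
  finally have "real (footrule (n k) (p k)) \<le> (real (n k))\<^sup>2 * (e + freq k (displaced e p k))"
    using e by (simp add: power2_eq_square algebra_simps mult_right_mono)
  then have "real (card (inversions (n k) (p k))) \<le> (real (n k))\<^sup>2 * (4 * (e + freq k (displaced e p k)))"
    using inversions_le_footrule[of "n k" "p k"] by linarith
  from coxeter_length_le[OF n this] show ?thesis by simp
qed

lemma cox_eq_0_iff:
  assumes p: "p \<in> carrier (sym_product n)"
  shows "cox p = 0 \<longleftrightarrow> (\<forall>e>0. dens (displaced e p) = 0)"
proof
  from p have perm: "p k permutes {1..n k}" for k by (simp add: carrier_sym_product)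
  assume 0: "cox p = 0"
  show "\<forall>e>0. dens (displaced e p) = 0"
  proof (intro allI impI)
    fix e :: real assume e: "e > 0"
    have "((\<lambda>k. coxeter_length (n k) (p k) / e) \<longlongrightarrow> 0 / e) \<omega>"
      using tendsto_cox[of p] e unfolding 0 by (intro tendsto_divide tendsto_const) auto
    then have "dens (displaced e p) \<le> 0 / e"
      by (rule dens_le, use eventually_n_ge[of 2] in eventually_elim)
        (use displaced_freq_le[of p, OF perm e] in blast)
    with dens_bounds[of "displaced e p"] show "dens (displaced e p) = 0" by simp
  qed
next
  from p have perm: "p k permutes {1..n k}" for k by (simp add: carrier_sym_product)
  assume 0: "\<forall>e>0. dens (displaced e p) = 0"
  have "cox p \<le> 0 + e" if "e > 0" for e
  proof -
    \<comment> \<open>The threshold e / 16 absorbs the constant 16, leaving e in the limit.\<close>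
    have d: "dens (displaced (e / 16) p) = 0" using 0 that by simp
    have "((\<lambda>k. 16 * (e / 16 + freq k (displaced (e / 16) p k))) \<longlongrightarrow> 16 * (e / 16 + 0)) \<omega>"
      using tendsto_dens[of "displaced (e / 16) p"] unfolding d
      by (intro tendsto_mult tendsto_add tendsto_const)
    moreover have "\<forall>\<^sub>F k in \<omega>. coxeter_length (n k) (p k) \<le> 16 * (e / 16 + freq k (displaced (e / 16) p k))"
      using eventually_n_ge[of 2]
      by eventually_elim (rule coxeter_length_displaced_le, use perm that in auto)
    ultimately have "cox p \<le> 16 * (e / 16 + 0)"
      by (rule tendsto_le[OF ultra_ne_bot _ tendsto_cox])
    then show ?thesis by simp
  qed
  then have "cox p \<le> 0" by (rule field_le_epsilon)
  moreover have "cox p \<ge> 0" unfolding cox_def using tendsto_Lim_ultra(2)[OF coxeter_length_bounds] by simp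
  ultimately show "cox p = 0" by simp
qed

lemma displaced_standard_part:
  assumes "p \<in> carrier (sym_product n)" "x \<in> loeb_seqs n"
  shows "((\<lambda>k. \<bar>real (p k (x k)) - real (x k)\<bar> / real (n k)) \<longlongrightarrow>
           \<bar>st (loeb_act \<omega> n p (cls x)) - st (cls x)\<bar>) \<omega>"
proof -
  have "((\<lambda>k. \<bar>real (p k (x k)) / real (n k) - real (x k) / real (n k)\<bar>) \<longlongrightarrow>
           \<bar>st (loeb_act \<omega> n p (cls x)) - st (cls x)\<bar>) \<omega>"
    unfolding act_cls[OF assms]
    by (rule tendsto_rabs[OF tendsto_diff[OF standard_part_tendsto(1)[OF perm_seq[OF assms]]
            standard_part_tendsto(1)[OF assms(2)]]])
  then show ?thesis by (simp add: diff_divide_distrib[symmetric])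
qed

lemma dens_eq_0I:
  assumes "AE c in L. c \<notin> internal_set \<omega> n A"
  shows "dens A = 0"
proof -
  have "emeasure L (internal_set \<omega> n A) = 0"
    using AE_iff_measurable[OF internal_sets_L[of A], of "\<lambda>c. c \<notin> internal_set \<omega> n A"] assms
      internal_subset_points[of A] by (auto simp: space_L)
  then show ?thesis using dens_bounds[of A] by (simp add: emeasure_internal)
qed

text \<open>Being moved by at least e * n k is an internal condition for each fixed e, and being
  moved in the standard part is the union of these conditions over e > 0. The thresholds 1/(m+1)
  suffice, which keeps the union of null sets countable.\<close>

lemma lift_id_iff:
  assumes p: "p \<in> carrier (sym_product n)"
  shows "lift p id \<longleftrightarrow> (\<forall>e>0. dens (displaced e p) = 0)"
proof
  assume l: "lift p id"
  show "\<forall>e>0. dens (displaced e p) = 0"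
  proof (intro allI impI dens_eq_0I)
    fix e :: real assume e: "e > 0"
    show "AE c in L. c \<notin> internal_set \<omega> n (displaced e p)"
      using l[unfolded lift_def] AE_space
    proof eventually_elim
      case (elim c)
      then obtain x where x: "x \<in> loeb_seqs n" "c = cls x"
        by (auto simp: space_L elim: loeb_points_cases)
      have "((\<lambda>k. \<bar>real (p k (x k)) - real (x k)\<bar> / real (n k)) \<longlongrightarrow> 0) \<omega>"
        using displaced_standard_part[OF p x(1)] elim(1) by (simp only: x(2)) simp
      then have "eventually (\<lambda>k. \<bar>real (p k (x k)) - real (x k)\<bar> / real (n k) < e) \<omega>"
        using e by (rule order_tendstoD)
      then have "eventually (\<lambda>k. \<not> x k \<in> displaced e p k) \<omega>"
        by eventually_elim (simp add: displaced_def divide_less_eq not_le)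
      then show ?case unfolding x(2) cls_in_internal_iff[OF x(1)] eventually_not_iff .
    qed
  qed
next
  assume 0: "\<forall>e>0. dens (displaced e p) = 0"
  have "AE c in L. \<forall>m. c \<notin> internal_set \<omega> n (displaced (inverse (real (Suc m))) p)"
    unfolding AE_all_countable using 0 by (intro allI AE_internal_null) simp
  then show "lift p id"
    unfolding lift_def using AE_space
  proof eventually_elim
    case (elim c)
    then obtain x where x: "x \<in> loeb_seqs n" "c = cls x"
      by (auto simp: space_L elim: loeb_points_cases)
    have "\<bar>st (loeb_act \<omega> n p c) - st c\<bar> \<le> 0"
    proof (rule ccontr)
      assume "\<not> ?thesis"
      then obtain m where m: "inverse (real (Suc m)) < \<bar>st (loeb_act \<omega> n p c) - st c\<bar>"
        using reals_Archimedean not_le by blast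
      have "eventually (\<lambda>k. inverse (real (Suc m)) < \<bar>real (p k (x k)) - real (x k)\<bar> / real (n k)) \<omega>"
        using displaced_standard_part[OF p x(1), folded x(2)] m by (rule order_tendstoD)
      then have "eventually (\<lambda>k. x k \<in> displaced (inverse (real (Suc m))) p k) \<omega>"
        by eventually_elim (simp add: displaced_def less_divide_eq)
      with elim(1) show False unfolding x(2) cls_in_internal_iff[OF x(1)] by blast
    qed
    then show ?case by simp
  qed
qed

lemma cos_in_ell0_iff:
  assumes p: "p \<in> carrier (sym_product n)"
  shows "sofic_class p \<in> ell0 \<omega> n \<longleftrightarrow> lift p id"
  using p by (simp add: ell0_def cos_in_sofic sofic_coxeter_length_cos cox_eq_0_iff lift_id_iff)

text \<open>Besides exactness in the middle this provides the group structure of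
  \<open>ell0\<close>: as a kernel it is a subgroup of \<open>GA\<close>, so no Coxeter length of a
  product has to be estimated.\<close>

lemma kernel_restriction:
  "kernel ((sofic_group \<omega> n)\<lparr>carrier := GA \<omega> n\<rparr>) (Aut_group unit_interval) (restriction \<omega> n) = ell0 \<omega> n"
proof -
  have one: "\<one>\<^bsub>Aut_group unit_interval\<^esub> = ae_rel unit_interval `` {id}"
    by (simp add: Aut_group_def)
  show ?thesis
  proof (intro equalityI subsetI)
    fix P assume "P \<in> kernel ((sofic_group \<omega> n)\<lparr>carrier := GA \<omega> n\<rparr>) (Aut_group unit_interval) (restriction \<omega> n)"
    then have P: "P \<in> GA \<omega> n" "restriction \<omega> n P = ae_rel unit_interval `` {id}"
      by (simp_all add: kernel_def one)
    obtain p \<phi> where p: "p \<in> carrier (sym_product n)" "P = sofic_class p" "lift p \<phi>" "\<phi> \<in> automorphisms unit_interval"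
      using P(1) by (rule GA_cases)
    have "id \<in> restriction \<omega> n P"
      unfolding P(2) using equiv_class_self[OF equiv_ae_rel id_automorphism] .
    then have "lift p id"
      using restricts_to_aut_iff[OF p(1) id_automorphism] unfolding restriction_def p(2) by blast
    then show "P \<in> ell0 \<omega> n" using p by (simp add: cos_in_ell0_iff)
  next
    fix P assume P: "P \<in> ell0 \<omega> n"
    then obtain p where p: "p \<in> carrier (sym_product n)" "P = sofic_class p"
      by (auto simp: ell0_def elim: sofic_cases)
    with P have "lift p id" by (simp add: cos_in_ell0_iff)
    then show "P \<in> kernel ((sofic_group \<omega> n)\<lparr>carrier := GA \<omega> n\<rparr>) (Aut_group unit_interval) (restriction \<omega> n)"
      using p by (simp add: kernel_def one GA_I restriction_cos id_automorphism)
  qed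
qed

end

section \<open>Lifting automorphisms\<close>

definition cell_average :: "nat \<Rightarrow> (real \<Rightarrow> real) \<Rightarrow> nat \<Rightarrow> real" where
  "cell_average m h i = real m * integral {(real i - 1) / real m..real i / real m} h"

lemma cell_subset:
  assumes "i \<in> {1..m}"
  shows "{(real i - 1) / real m..real i / real m} \<subseteq> {0..1}"
  using assms by (auto simp: divide_le_eq_1 intro: order_trans)

lemma cell_integrable:
  fixes h :: "real \<Rightarrow> real"
  assumes "h integrable_on {0..1}" "i \<in> {1..m}"
  shows "h integrable_on {(real i - 1) / real m..real i / real m}"
  using integrable_subinterval_real[OF assms(1) cell_subset[OF assms(2)]] .

lemma sum_integral_cells:
  fixes h :: "real \<Rightarrow> real"
  assumes h: "h integrable_on {0..1}" and m: "m > 0"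
  shows "(\<Sum>i\<in>{1..m}. integral {(real i - 1) / real m..real i / real m} h) = integral {0..1} h"
proof -
  have "j \<le> m \<Longrightarrow> (\<Sum>i\<in>{1..j}. integral {(real i - 1) / real m..real i / real m} h) = integral {0..real j / real m} h" for j
  proof (induction j)
    case (Suc j)
    have "integral {0..real j / real m} h + integral {real j / real m..real (Suc j) / real m} h
        = integral {0..real (Suc j) / real m} h"
    proof (rule Henstock_Kurzweil_Integration.integral_combine)
      have "real (Suc j) / real m \<le> 1" using Suc.prems m by (simp add: divide_le_eq_1)
      then show "h integrable_on {0..real (Suc j) / real m}"
        by (intro integrable_subinterval_real[OF h]) auto
    qed (auto intro: divide_right_mono)
    moreover have "{1..Suc j} = insert (Suc j) {1..j}" by auto
    ultimately show ?case using Suc by simp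
  qed simp
  from this[of m] m show ?thesis by simp
qed

text \<open>The triangle inequality for integrals on each cell, summed. The factor m is kept because
  \<open>freq_Markov\<close> takes its bound relative to the number of cells.\<close>

lemma cell_average_diff_le:
  fixes \<phi> g :: "real \<Rightarrow> real"
  assumes "\<phi> integrable_on {0..1}" "g integrable_on {0..1}" "(\<lambda>r. \<bar>\<phi> r - g r\<bar>) integrable_on {0..1}"
    and m: "m > 0"
  shows "(\<Sum>i\<in>{1..m}. \<bar>cell_average m \<phi> i - cell_average m g i\<bar>)
           \<le> real m * integral {0..1} (\<lambda>r. \<bar>\<phi> r - g r\<bar>)"
proof -
  have "\<bar>cell_average m \<phi> i - cell_average m g i\<bar> \<le>
      real m * integral {(real i - 1) / real m..real i / real m} (\<lambda>r. \<bar>\<phi> r - g r\<bar>)" if i: "i \<in> {1..m}" for i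
  proof -
    let ?I = "{(real i - 1) / real m..real i / real m}"
    have int: "\<phi> integrable_on ?I" "g integrable_on ?I" "(\<lambda>r. \<bar>\<phi> r - g r\<bar>) integrable_on ?I"
      using assms(1-3) i by (auto intro: cell_integrable)
    have "\<bar>integral ?I \<phi> - integral ?I g\<bar> = norm (integral ?I (\<lambda>r. \<phi> r - g r))"
      using int by (simp add: Henstock_Kurzweil_Integration.integral_diff)
    also have "\<dots> \<le> integral ?I (\<lambda>r. \<bar>\<phi> r - g r\<bar>)"
      using int by (intro Henstock_Kurzweil_Integration.integral_norm_bound_integral integrable_diff) auto
    finally have "real m * \<bar>integral ?I \<phi> - integral ?I g\<bar> \<le> real m * integral ?I (\<lambda>r. \<bar>\<phi> r - g r\<bar>)"
      by (rule mult_left_mono) simp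
    then show ?thesis
      by (simp add: cell_average_def right_diff_distrib[symmetric] abs_mult)
  qed
  then have "(\<Sum>i\<in>{1..m}. \<bar>cell_average m \<phi> i - cell_average m g i\<bar>) \<le>
      (\<Sum>i\<in>{1..m}. real m * integral {(real i - 1) / real m..real i / real m} (\<lambda>r. \<bar>\<phi> r - g r\<bar>))"
    by (rule sum_mono)
  also have "\<dots> = real m * integral {0..1} (\<lambda>r. \<bar>\<phi> r - g r\<bar>)"
    by (simp add: sum_distrib_left[symmetric] sum_integral_cells[OF assms(3) m])
  finally show ?thesis .
qed

text \<open>Every point of a cell is within 1/m of its right end, so uniform continuity yields one N
  for all cells.\<close>

lemma cell_average_continuous:
  fixes g :: "real \<Rightarrow> real"
  assumes g: "continuous_on {0..1} g" and e: "e > 0"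
  obtains N where "\<And>m i. m \<ge> N \<Longrightarrow> i \<in> {1..m} \<Longrightarrow> \<bar>cell_average m g i - g (real i / real m)\<bar> \<le> e"
proof -
  have "uniformly_continuous_on {0..1} g"
    using g by (rule compact_uniformly_continuous) simp
  then obtain d where d: "d > 0" "\<And>x y. x \<in> {0..1} \<Longrightarrow> y \<in> {0..1} \<Longrightarrow> dist y x < d \<Longrightarrow> dist (g y) (g x) < e"
    unfolding uniformly_continuous_on_def using e by blast
  obtain N :: nat where N: "inverse (real (Suc N)) < d" using reals_Archimedean[OF d(1)] by blast
  show thesis
  proof (rule that[of "Suc N"])
    fix m i assume mi: "m \<ge> Suc N" "i \<in> {1..m}"
    let ?a = "(real i - 1) / real m" and ?b = "real i / real m"
    have m: "real m > 0" using mi by simp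
    have "1 / real m \<le> inverse (real (Suc N))"
      using mi(1) by (simp add: inverse_eq_divide frac_le del: of_nat_Suc)
    with N have small: "1 / real m < d" by simp
    have len: "?b - ?a = 1 / real m" by (simp add: diff_divide_distrib)
    then have ab: "?a \<le> ?b" using m by (simp add: divide_right_mono)
    have int: "g integrable_on {?a..?b}"
      using cell_integrable[OF integrable_continuous_interval[OF g] mi(2)] .
    have "norm (integral {?a..?b} (\<lambda>r. g r - g ?b)) \<le> integral {?a..?b} (\<lambda>r. e)"
    proof (rule Henstock_Kurzweil_Integration.integral_norm_bound_integral)
      show "(\<lambda>r. g r - g ?b) integrable_on {?a..?b}" using int by (intro integrable_diff) auto
      fix r assume r: "r \<in> {?a..?b}"
      then have "r \<in> {0..1}" "?b \<in> {0..1}" using cell_subset[OF mi(2)] ab by auto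
      moreover have "dist r ?b < d" using r len small by (auto simp: dist_real_def)
      ultimately show "norm (g r - g ?b) \<le> e" using d(2)[of ?b r] by (simp add: dist_real_def)
    qed (rule integrable_const_ivl)
    also have "integral {?a..?b} (\<lambda>r. e) = e / real m" using ab len by simp
    also have "integral {?a..?b} (\<lambda>r. g r - g ?b) = integral {?a..?b} g - g ?b / real m"
      using int ab len by (subst Henstock_Kurzweil_Integration.integral_diff) auto
    finally have *: "\<bar>integral {?a..?b} g - g ?b / real m\<bar> \<le> e / real m" by simp
    have "cell_average m g i - g ?b = real m * (integral {?a..?b} g - g ?b / real m)"
      using m by (simp add: cell_average_def right_diff_distrib)
    then have "\<bar>cell_average m g i - g ?b\<bar> = real m * \<bar>integral {?a..?b} g - g ?b / real m\<bar>"
      by (simp add: abs_mult)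
    also have "\<dots> \<le> real m * (e / real m)" using * by (rule mult_left_mono) simp
    finally show "\<bar>cell_average m g i - g ?b\<bar> \<le> e" using m by simp
  qed
qed

text \<open>\<open>measurable_on\<close> provides continuous functions converging off a negligible
  set. Clamping them to [0,1] keeps the limit, since \<phi> takes values there, and makes the
  constant 1 a dominating function.\<close>

lemma continuous_approximation:
  fixes \<phi> :: "real \<Rightarrow> real"
  assumes meas: "\<phi> \<in> borel_measurable unit_interval" and range: "\<phi> \<in> {0..1} \<rightarrow> {0..1}"
  obtains g :: "nat \<Rightarrow> real \<Rightarrow> real" where "\<And>m. continuous_on {0..1} (g m)"
    "AE r in unit_interval. (\<lambda>m. g m r) \<longlonglongrightarrow> \<phi> r"
    "\<And>m. (\<lambda>r. \<bar>\<phi> r - g m r\<bar>) integrable_on {0..1}"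
    "(\<lambda>m. integral {0..1} (\<lambda>r. \<bar>\<phi> r - g m r\<bar>)) \<longlonglongrightarrow> 0"
proof -
  have "\<phi> measurable_on {0..1}" using meas by (simp add: measurable_on_iff_borel_measurable)
  then obtain N f where N: "negligible N" and f: "\<And>m. continuous_on UNIV (f m)"
    and lim: "\<And>x. x \<notin> N \<Longrightarrow> (\<lambda>m. f m x) \<longlonglongrightarrow> (if x \<in> {0..1} then \<phi> x else 0)"
    unfolding measurable_on_def by blast
  define g where "g m r = max 0 (min 1 (f m r))" for m r
  have cont: "continuous_on {0..1} (g m)" for m
    unfolding g_def by (intro continuous_intros continuous_on_subset[OF f]) auto
  have lim': "(\<lambda>m. g m r) \<longlonglongrightarrow> \<phi> r" if "r \<in> {0..1}" "r \<notin> N" for r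
  proof -
    have "(\<lambda>m. g m r) \<longlonglongrightarrow> max 0 (min 1 (\<phi> r))"
      unfolding g_def using lim[OF that(2)] that(1) by (intro tendsto_max tendsto_min tendsto_const) simp
    then show ?thesis using range that(1) by (auto simp: Pi_iff)
  qed
  have int: "(\<lambda>r. \<bar>\<phi> r - g m r\<bar>) integrable_on {0..1}" for m
  proof (rule measurable_bounded_by_integrable_imp_integrable)
    show "(\<lambda>r. \<bar>\<phi> r - g m r\<bar>) \<in> borel_measurable unit_interval"
      using continuous_imp_measurable_on_sets_lebesgue[OF cont] meas by simp
    show "(\<lambda>r. 1 :: real) integrable_on {0..1::real}" by (rule integrable_const_ivl)
    show "norm \<bar>\<phi> r - g m r\<bar> \<le> 1" if "r \<in> {0..1}" for r
    proof -
      have "\<phi> r \<in> {0..1}" using range that by blast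
      moreover have "g m r \<in> {0..1}" by (auto simp: g_def)
      ultimately show ?thesis by auto
    qed
  qed simp
  \<comment> \<open>The integrand is set to 0 on N because this form of dominated convergence asks
    for convergence at every point; \<open>integral_spike\<close> undoes the change.\<close>
  have "(\<lambda>m. integral {0..1} (\<lambda>r. if r \<in> N then 0 else \<bar>\<phi> r - g m r\<bar>)) \<longlonglongrightarrow> integral {0..1::real} (\<lambda>r. 0 :: real)"
  proof (rule dominated_convergence(2)[where h = "\<lambda>r. 1"])
    show "(\<lambda>r. if r \<in> N then 0 else \<bar>\<phi> r - g m r\<bar>) integrable_on {0..1}" for m
      by (rule integrable_spike[OF int[of m] N]) auto
    show "(\<lambda>r. 1 :: real) integrable_on {0..1::real}" by (rule integrable_const_ivl)
    show "norm (if r \<in> N then 0 else \<bar>\<phi> r - g m r\<bar>) \<le> 1" if "r \<in> {0..1}" for r m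
    proof -
      have "\<phi> r \<in> {0..1}" using range that by blast
      moreover have "g m r \<in> {0..1}" by (auto simp: g_def)
      ultimately show ?thesis by auto
    qed
    show "(\<lambda>m. if r \<in> N then 0 else \<bar>\<phi> r - g m r\<bar>) \<longlonglongrightarrow> 0" if "r \<in> {0..1}" for r
    proof (cases "r \<in> N")
      case False
      have "(\<lambda>m. \<bar>\<phi> r - g m r\<bar>) \<longlonglongrightarrow> \<bar>\<phi> r - \<phi> r\<bar>"
        by (intro tendsto_rabs tendsto_diff tendsto_const lim'[OF that False])
      with False show ?thesis by simp
    qed simp
  qed
  moreover have "integral {0..1} (\<lambda>r. if r \<in> N then 0 else \<bar>\<phi> r - g m r\<bar>) = integral {0..1} (\<lambda>r. \<bar>\<phi> r - g m r\<bar>)" for m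
    by (rule integral_spike[OF N]) auto
  ultimately have "(\<lambda>m. integral {0..1} (\<lambda>r. \<bar>\<phi> r - g m r\<bar>)) \<longlonglongrightarrow> 0" by simp
  moreover have "AE r in unit_interval. (\<lambda>m. g m r) \<longlonglongrightarrow> \<phi> r"
  proof -
    have "AE r in lebesgue. r \<notin> N" using N by (intro AE_not_in) (simp add: negligible_iff_null_sets)
    then show ?thesis
      by (subst AE_restrict_space_iff) (auto elim!: eventually_mono intro: lim')
  qed
  ultimately show thesis using that cont int by blast
qed

text \<open>The position of \<open>i\<close> when \<open>{1..m}\<close> is sorted by the values of \<open>F\<close>, ties being broken by
  the index.\<close>

definition rank_below :: "(nat \<Rightarrow> real) \<Rightarrow> nat \<Rightarrow> nat set" where
  "rank_below F i = {j. F j < F i \<or> F j = F i \<and> j \<le> i}"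

definition rank_perm :: "nat \<Rightarrow> (nat \<Rightarrow> real) \<Rightarrow> nat \<Rightarrow> nat" where
  "rank_perm m F i = (if i \<in> {1..m} then card (rank_below F i \<inter> {1..m}) else i)"

text \<open>The tie-break makes the order linear, so the sets \<open>rank_below\<close> are strictly
  nested within \<open>{1..m}\<close> and have distinct sizes; an injective self-map of a finite set
  is bijective.\<close>

lemma rank_perm_permutes: "rank_perm m F permutes {1..m}"
proof (rule bij_imp_permutes)
  have less: "rank_perm m F i < rank_perm m F j"
    if ij: "i \<in> {1..m}" "j \<in> {1..m}" "i \<in> rank_below F j" "i \<noteq> j" for i j
  proof -
    have "rank_below F i \<subseteq> rank_below F j" "j \<in> rank_below F j" "j \<notin> rank_below F i"
      using ij by (auto simp: rank_below_def)
    then have "rank_below F i \<inter> {1..m} \<subset> rank_below F j \<inter> {1..m}" using ij by blast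
    then have "card (rank_below F i \<inter> {1..m}) < card (rank_below F j \<inter> {1..m})"
      by (intro psubset_card_mono) auto
    with ij show ?thesis by (simp add: rank_perm_def)
  qed
  have "inj_on (rank_perm m F) {1..m}"
  proof (rule inj_onI, rule ccontr)
    fix i j assume *: "i \<in> {1..m}" "j \<in> {1..m}" "rank_perm m F i = rank_perm m F j" "i \<noteq> j"
    have "i \<in> rank_below F j \<or> j \<in> rank_below F i" by (auto simp: rank_below_def)
    then show False using less[of i j] less[of j i] * by auto
  qed
  moreover have "rank_perm m F ` {1..m} \<subseteq> {1..m}"
  proof safe
    fix i assume i: "i \<in> {1..m}"
    have "i \<in> rank_below F i \<inter> {1..m}" using i by (simp add: rank_below_def)
    then have "card (rank_below F i \<inter> {1..m}) > 0" by (subst card_gt_0_iff) auto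
    moreover have "card (rank_below F i \<inter> {1..m}) \<le> card {1..m}" by (rule card_mono) auto
    ultimately show "rank_perm m F i \<in> {1..m}" using i by (simp add: rank_perm_def)
  qed
  ultimately show "bij_betw (rank_perm m F) {1..m} {1..m}"
    by (simp add: bij_betw_def endo_inj_surj)
qed (auto simp: rank_perm_def)

context loeb
begin

text \<open>The densities need not be summable, so Borel-Cantelli does not apply. Instead the
  intersection of each tail is null, and almost every point escapes infinitely often. This is enough
  when combined with a convergence that holds for all large m.\<close>

lemma AE_frequently_notin_internal:
  assumes "(\<lambda>m. dens (E m)) \<longlonglongrightarrow> 0"
  shows "AE c in L. \<forall>M. \<exists>m\<ge>M. c \<notin> internal_set \<omega> n (E m)"
  unfolding AE_all_countable
proof
  fix M :: nat
  let ?I = "\<Inter>m\<in>{M..}. internal_set \<omega> n (E m)"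
  have I: "?I \<in> sets L" by (rule sets.countable_INT') (auto simp: internal_sets_L)
  have "emeasure L ?I \<le> ennreal (dens (E m))" if "m \<ge> M" for m
    using that by (subst emeasure_internal[symmetric]) (auto intro!: emeasure_mono internal_sets_L)
  then have "eventually (\<lambda>m. emeasure L ?I \<le> ennreal (dens (E m))) sequentially"
    by (auto simp: eventually_sequentially)
  moreover have "(\<lambda>m. ennreal (dens (E m))) \<longlonglongrightarrow> ennreal 0" using assms by (rule tendsto_ennrealI)
  ultimately have "emeasure L ?I \<le> 0"
    by (intro tendsto_lowerbound[OF _ _ sequentially_bot]) auto
  with I have "?I \<in> null_sets L" by (auto simp: null_sets_def)
  then have "AE c in L. c \<notin> ?I" by (rule AE_not_in)
  then show "AE c in L. \<exists>m\<ge>M. c \<notin> internal_set \<omega> n (E m)" by eventually_elim auto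
qed

lemma freq_Markov:
  assumes e: "e > 0" and H: "\<And>i. i \<in> {1..n k} \<Longrightarrow> 0 \<le> H i"
    and sum: "(\<Sum>i\<in>{1..n k}. H i) \<le> real (n k) * b"
  shows "freq k {i. H i \<ge> e} \<le> b / e"
proof -
  let ?A = "{i. H i \<ge> e} \<inter> {1..n k}"
  have "real (card ?A) * e = (\<Sum>i\<in>?A. e)" by simp
  also have "\<dots> \<le> (\<Sum>i\<in>?A. H i)" by (rule sum_mono) auto
  also have "\<dots> \<le> (\<Sum>i\<in>{1..n k}. H i)" using H by (intro sum_mono2) auto
  also note sum
  finally have "real (card ?A) * e \<le> real (n k) * b" .
  then have "real (card ?A) \<le> real (n k) * b / e" using e by (simp add: le_divide_eq)
  then have "real (card ?A) / real (n k) \<le> (real (n k) * b / e) / real (n k)"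
    by (rule divide_right_mono) simp
  also have "\<dots> = b / e" by simp
  finally show ?thesis unfolding freq_def .
qed

text \<open>Cell averages are contractive for the \<open>L\<^sup>1\<close> norm and reproduce continuous functions up to an
  infinitesimal error, so the averages of \<open>\<phi>\<close> are close to those of a continuous
  approximation of \<open>\<phi>\<close>.\<close>

lemma cell_average_lifts:
  assumes meas: "\<phi> \<in> borel_measurable unit_interval" and range: "\<phi> \<in> {0..1} \<rightarrow> {0..1}"
  shows "AE c in L. \<forall>x\<in>loeb_seqs n. c = cls x \<longrightarrow>
           ((\<lambda>k. cell_average (n k) \<phi> (x k)) \<longlongrightarrow> \<phi> (st c)) \<omega>"
proof -
  obtain g where g: "\<And>m. continuous_on {0..1} (g m)"
    "AE r in unit_interval. (\<lambda>m. g m r) \<longlonglongrightarrow> \<phi> r"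
    "\<And>m. (\<lambda>r. \<bar>\<phi> r - g m r\<bar>) integrable_on {0..1}"
    "(\<lambda>m. integral {0..1} (\<lambda>r. \<bar>\<phi> r - g m r\<bar>)) \<longlonglongrightarrow> 0"
    by (rule continuous_approximation[OF meas range]) (rule that)
  have \<phi>_int: "\<phi> integrable_on {0..1}"
    by (rule measurable_bounded_by_integrable_imp_integrable[OF meas integrable_const_ivl[of 1]])
      (use range in \<open>auto simp: Pi_iff\<close>)
  define E where "E e m k = {i. \<bar>cell_average (n k) \<phi> i - cell_average (n k) (g m) i\<bar> \<ge> e}" for e m k
  have dens_E: "dens (E e m) \<le> integral {0..1} (\<lambda>r. \<bar>\<phi> r - g m r\<bar>) / e" if "e > 0" for e m
    using that unfolding E_def
    by (intro dens_le[OF tendsto_const] always_eventually allI freq_Markov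
        cell_average_diff_le \<phi>_int integrable_continuous_interval g) auto
  have "(\<lambda>m. dens (E e m)) \<longlonglongrightarrow> 0" if e: "e > 0" for e
  proof (rule tendsto_sandwich[of "\<lambda>_. 0"])
    show "(\<lambda>m. integral {0..1} (\<lambda>r. \<bar>\<phi> r - g m r\<bar>) / e) \<longlonglongrightarrow> 0"
      using tendsto_divide[OF g(4) tendsto_const, of e] e by simp
  qed (use dens_bounds dens_E[OF e] in auto)
  \<comment> \<open>Restricting the thresholds to 1/(j+1) lets a single null set serve all of
    them.\<close>
  then have "AE c in L. \<forall>j. \<forall>M. \<exists>m\<ge>M. c \<notin> internal_set \<omega> n (E (inverse (real (Suc j))) m)"
    by (subst AE_all_countable) (intro allI AE_frequently_notin_internal, simp)
  then show ?thesis
    using AE_standard_part[OF g(2)]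
  proof eventually_elim
    case (elim c)
    show ?case
    proof (intro ballI impI tendstoI)
      fix x e assume x: "x \<in> loeb_seqs n" "c = cls x" and e: "(0::real) < e"
      \<comment> \<open>Four errors: between the cell averages of \<phi> and of g m, between the
        average of g m and its value at x k / n k, between that value and g m (st c), and between g
        m (st c) and \<phi> (st c).\<close>
      then have "0 < e / 4" by simp
      then obtain j where j: "inverse (real (Suc j)) < e / 4" using reals_Archimedean by blast
      have "eventually (\<lambda>m. dist (g m (st c)) (\<phi> (st c)) < e / 4) sequentially"
        using elim(2) \<open>0 < e / 4\<close> by (rule tendstoD)
      then obtain M where M: "\<And>m. m \<ge> M \<Longrightarrow> dist (g m (st c)) (\<phi> (st c)) < e / 4"
        by (auto simp: eventually_sequentially)
      \<comment> \<open>Pointwise approximation holds for all m \<ge> M, while c escapes the bad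
        sets for infinitely many m, so one m does both.\<close>
      from elim(1) obtain m where m: "m \<ge> M" "c \<notin> internal_set \<omega> n (E (inverse (real (Suc j))) m)"
        by blast
      have 1: "eventually (\<lambda>k. \<not> x k \<in> E (inverse (real (Suc j))) m k) \<omega>"
        using m(2) unfolding x(2) cls_in_internal_iff[OF x(1)] eventually_not_iff .
      obtain N where N: "\<And>l i. l \<ge> N \<Longrightarrow> i \<in> {1..l} \<Longrightarrow> \<bar>cell_average l (g m) i - g m (real i / real l)\<bar> \<le> e / 4"
        using cell_average_continuous[OF g(1)[of m] \<open>0 < e / 4\<close>] by blast
      have "((\<lambda>k. g m (real (x k) / real (n k))) \<longlongrightarrow> g m (st c)) \<omega>"
        using standard_part_tendsto[OF x(1)] coord_bounds[OF x(1)] unfolding x(2)[symmetric]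
        by (intro continuous_on_tendsto_compose[OF g(1)[of m]]) auto
      then have "eventually (\<lambda>k. dist (g m (real (x k) / real (n k))) (g m (st c)) < e / 4) \<omega>"
        using \<open>0 < e / 4\<close> by (rule tendstoD)
      with 1 eventually_n_ge[of N]
      show "eventually (\<lambda>k. dist (cell_average (n k) \<phi> (x k)) (\<phi> (st c)) < e) \<omega>"
      proof eventually_elim
        case (elim k)
        have "\<bar>cell_average (n k) (g m) (x k) - g m (real (x k) / real (n k))\<bar> \<le> e / 4"
          using N[OF elim(2)] x(1) by (simp add: loeb_seqs_iff)
        moreover have "\<bar>cell_average (n k) \<phi> (x k) - cell_average (n k) (g m) (x k)\<bar> < e / 4"
          using elim(1) j unfolding E_def by simp
        moreover note elim(3) M[OF m(1)]
        ultimately show ?case unfolding dist_real_def by linarith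
      qed
    qed
  qed
qed

lemma emeasure_standard_part_preserving:
  assumes \<phi>: "\<phi> \<in> measure_preserving_maps unit_interval" and B: "B \<in> sets unit_interval"
  shows "{c \<in> loeb_points \<omega> n. \<phi> (st c) \<in> B} \<in> sets L"
    and "emeasure L {c \<in> loeb_points \<omega> n. \<phi> (st c) \<in> B} = emeasure unit_interval B"
proof -
  let ?C = "\<phi> -` B \<inter> space unit_interval"
  have C: "?C \<in> sets unit_interval" "emeasure unit_interval ?C = emeasure unit_interval B"
    using \<phi> B measurable_sets[of \<phi> unit_interval unit_interval B]
    by (simp_all add: measure_preserving_maps_def)
  have eq: "{c \<in> loeb_points \<omega> n. \<phi> (st c) \<in> B} = st -` ?C \<inter> loeb_points \<omega> n"
    using standard_part_bounds by auto
  show "{c \<in> loeb_points \<omega> n. \<phi> (st c) \<in> B} \<in> sets L"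
    "emeasure L {c \<in> loeb_points \<omega> n. \<phi> (st c) \<in> B} = emeasure unit_interval B"
    unfolding eq using standard_part_vimage[OF C(1)] C(2) by simp_all
qed

text \<open>The points ranked below \<open>x\<close> lie, up to null sets, between \<open>{y. \<phi> (st y) < a}\<close> and
  \<open>{y. \<phi> (st y) \<le> a}\<close> for \<open>a = \<phi> (st x)\<close>, and both sets have measure \<open>a\<close>.\<close>

lemma rank_perm_lift:
  assumes \<phi>: "\<phi> \<in> measure_preserving_maps unit_interval"
    and F: "AE c in L. \<forall>x\<in>loeb_seqs n. c = cls x \<longrightarrow> ((\<lambda>k. F k (x k)) \<longlongrightarrow> \<phi> (st c)) \<omega>"
  shows "lift (\<lambda>k. rank_perm (n k) (F k)) \<phi>"
proof -
  have p: "(\<lambda>k. rank_perm (n k) (F k)) \<in> carrier (sym_product n)"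
    by (simp add: carrier_sym_product rank_perm_permutes)
  have bounds: "\<phi> r \<in> {0..1}" if "r \<in> {0..1}" for r
    using \<phi> that measurable_space[of \<phi> unit_interval unit_interval r]
    by (simp add: measure_preserving_maps_def)
  show ?thesis
    unfolding lift_def using F AE_space
  proof eventually_elim
    case (elim c)
    then obtain x where x: "x \<in> loeb_seqs n" "c = cls x"
      by (auto simp: space_L elim: loeb_points_cases)
    define a where "a = \<phi> (st c)"
    define R where "R k = rank_below (F k) (x k)" for k
    have Fx: "((\<lambda>k. F k (x k)) \<longlongrightarrow> a) \<omega>" using elim(1) x by (simp add: a_def)
    have a: "a \<in> {0..1}" unfolding a_def using bounds standard_part_tendsto(2)[OF x(1)] x(2) by blast
    have "rank_perm (n k) (F k) (x k) = card (R k \<inter> {1..n k})" for k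
      using x(1) by (simp add: rank_perm_def R_def loeb_seqs_iff)
    then have "((\<lambda>k. real (rank_perm (n k) (F k) (x k)) / real (n k)) \<longlongrightarrow> dens R) \<omega>"
      using tendsto_dens[of R] by (simp add: freq_def)
    then have st: "st (loeb_act \<omega> n (\<lambda>k. rank_perm (n k) (F k)) c) = dens R"
      unfolding x(2) act_cls[OF p x(1)] by (rule standard_part_eqI[OF perm_seq[OF p x(1)]])
    have iv: "{0..a} \<in> sets unit_interval" "{0..<a} \<in> sets unit_interval"
      "emeasure unit_interval {0..a} = ennreal a" "emeasure unit_interval {0..<a} = ennreal a"
    proof -
      have "{0..a} \<subseteq> {0..1}" "{0..<a} \<subseteq> {0..1}" using a by auto
      then show "{0..a} \<in> sets unit_interval" "{0..<a} \<in> sets unit_interval"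
        "emeasure unit_interval {0..a} = ennreal a" "emeasure unit_interval {0..<a} = ennreal a"
        using a by (simp_all add: sets_restrict_space_iff emeasure_restrict_space)
    qed
    \<comment> \<open>Where \<phi> (st y) = a, membership in the internal set of R hinges on
      infinitesimal differences of F and on ties. Such points cost nothing, because
      \<open>{0..<a}\<close> and \<open>{0..a}\<close> have the same measure.\<close>
    let ?lt = "{y \<in> loeb_points \<omega> n. \<phi> (st y) \<in> {0..<a}}"
      and ?le = "{y \<in> loeb_points \<omega> n. \<phi> (st y) \<in> {0..a}}"
    \<comment> \<open>R depends on the fixed point c, so the hypothesis on F is used a second time,
      now for the varying point y.\<close>
    have "AE y in L. (y \<in> ?lt \<longrightarrow> y \<in> internal_set \<omega> n R) \<and> (y \<in> internal_set \<omega> n R \<longrightarrow> y \<in> ?le)"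
      using F AE_space
    proof eventually_elim
      case (elim y)
      then obtain z where z: "z \<in> loeb_seqs n" "y = cls z"
        by (auto simp: space_L elim: loeb_points_cases)
      have Fz: "((\<lambda>k. F k (z k)) \<longlongrightarrow> \<phi> (st y)) \<omega>" using elim(1) z by simp
      have yb: "\<phi> (st y) \<in> {0..1}" using bounds standard_part_tendsto(2)[OF z(1)] z(2) by blast
      have "y \<in> internal_set \<omega> n R" if "\<phi> (st y) < a"
      proof -
        have "eventually (\<lambda>k. F k (x k) - F k (z k) > 0) \<omega>"
          using tendsto_diff[OF Fx Fz] by (rule order_tendstoD) (use that in simp)
        then have "eventually (\<lambda>k. z k \<in> R k) \<omega>"
          by eventually_elim (simp add: R_def rank_below_def)
        then show ?thesis using z by (simp add: cls_in_internal_iff)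
      qed
      moreover have "\<phi> (st y) \<le> a" if "y \<in> internal_set \<omega> n R"
      proof -
        have "eventually (\<lambda>k. z k \<in> R k) \<omega>" using that z by (simp add: cls_in_internal_iff)
        then have "eventually (\<lambda>k. F k (z k) \<le> F k (x k)) \<omega>"
          by eventually_elim (auto simp: R_def rank_below_def)
        then show ?thesis by (rule tendsto_le[OF ultra_ne_bot Fx Fz])
      qed
      ultimately show ?case using yb elim(2) by (auto simp: space_L)
    qed
    then have lt: "AE y in L. y \<in> ?lt \<longrightarrow> y \<in> internal_set \<omega> n R"
      and le: "AE y in L. y \<in> internal_set \<omega> n R \<longrightarrow> y \<in> ?le"
      by (auto simp: AE_conj_iff)
    have "emeasure L ?lt \<le> emeasure L (internal_set \<omega> n R)"
      by (rule emeasure_mono_AE[OF lt internal_sets_L])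
    moreover have "emeasure L (internal_set \<omega> n R) \<le> emeasure L ?le"
      by (rule emeasure_mono_AE[OF le emeasure_standard_part_preserving(1)[OF \<phi> iv(1)]])
    ultimately have "ennreal a \<le> ennreal (dens R)" "ennreal (dens R) \<le> ennreal a"
      unfolding emeasure_standard_part_preserving(2)[OF \<phi> iv(1)]
        emeasure_standard_part_preserving(2)[OF \<phi> iv(2)] emeasure_internal iv .
    then have "dens R = a" using a dens_bounds[of R] by (simp add: antisym)
    with st show ?case by (simp add: a_def)
  qed
qed

lemma restriction_surj:
  "restriction \<omega> n ` GA \<omega> n = carrier (Aut_group unit_interval)"
proof (intro equalityI subsetI)
  fix C assume "C \<in> restriction \<omega> n ` GA \<omega> n"
  then show "C \<in> carrier (Aut_group unit_interval)"
    using restriction_hom by (auto simp: hom_def)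
next
  fix C assume "C \<in> carrier (Aut_group unit_interval)"
  then obtain \<phi> where \<phi>: "\<phi> \<in> automorphisms unit_interval" "C = ae_rel unit_interval `` {\<phi>}"
    by (rule Aut_carrier_cases)
  let ?p = "\<lambda>k. rank_perm (n k) (cell_average (n k) \<phi>)"
  have p: "?p \<in> carrier (sym_product n)" by (simp add: carrier_sym_product rank_perm_permutes)
  have "lift ?p \<phi>"
    by (rule rank_perm_lift[OF automorphisms_mp[OF \<phi>(1)] cell_average_lifts[OF
          automorphism_borel_measurable[OF \<phi>(1)] automorphism_funcset[OF \<phi>(1)]]])
  with p \<phi> show "C \<in> restriction \<omega> n ` GA \<omega> n"
    by (intro image_eqI[of _ _ "sofic_class ?p"]) (simp_all add: restriction_cos GA_I)
qed

end

theorem theorem5p1: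
  fixes \<omega> :: "nat filter" and n :: "nat \<Rightarrow> nat"
  assumes "nonprincipal_ultrafilter \<omega>"
    and "strict_mono n"
    and "\<And>k. n k \<ge> 1"
  shows "short_exact
           ((sofic_group \<omega> n)\<lparr>carrier := ell0 \<omega> n\<rparr>)
           ((sofic_group \<omega> n)\<lparr>carrier := GA \<omega> n\<rparr>)
           (Aut_group unit_interval)
           (\<lambda>P. P)
           (restriction \<omega> n)"
proof -
  interpret loeb \<omega> n using assms by unfold_locales
  let ?G = "(sofic_group \<omega> n)\<lparr>carrier := GA \<omega> n\<rparr>"
  have G: "group ?G" by (rule group.subgroup_imp_group[OF group_sofic subgroup_GA])
  have hom: "group_hom ?G (Aut_group unit_interval) (restriction \<omega> n)"
    using G group_Aut restriction_hom by (simp add: group_hom_def group_hom_axioms_def)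
  have sub: "subgroup (ell0 \<omega> n) ?G"
    using group_hom.subgroup_kernel[OF hom] by (simp only: kernel_restriction)
  have "group ((sofic_group \<omega> n)\<lparr>carrier := ell0 \<omega> n\<rparr>)"
    using group.subgroup_imp_group[OF G sub] by simp
  moreover have "kernel ((sofic_group \<omega> n)\<lparr>carrier := ell0 \<omega> n\<rparr>) ?G (\<lambda>P. P) =
      {\<one>\<^bsub>(sofic_group \<omega> n)\<lparr>carrier := ell0 \<omega> n\<rparr>\<^esub>}"
    using subgroup.one_closed[OF sub] by (auto simp: kernel_def)
  moreover have "(\<lambda>P. P) \<in> hom ((sofic_group \<omega> n)\<lparr>carrier := ell0 \<omega> n\<rparr>) ?G"
    using subgroup.subset[OF sub] by (auto simp: hom_def)
  ultimately show ?thesis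
    using G group_Aut restriction_hom kernel_restriction restriction_surj
    by (simp add: short_exact_def)
qed

end
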